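(* Let $(M,J,g)$ be an $(\alpha,\varepsilon)$-metric manifold with $\alpha=-1$ and fundamental tensor $\phi(\cdot,\cdot)=g(J\cdot,\cdot)$, and let $\mathcal G_g$ be the generalized metric on $\mathbb TM=TM\oplus T^*M$ induced by $g$. Then, for $\lambda\in\{+1,-1\}$, the generalized almost complex structure $$\mathcal J_{\lambda,J}=\begin{pmatrix}J&0\\0&\lambda J^*\end{pmatrix}$$ is compatible with $\mathcal G_g$. In particular, when $\varepsilon=+1$, $(\mathcal J_{\lambda,J},\mathcal G_g)$ is a generalized almost Hermitian or indefinite almost Hermitian structure (depending on whether $g$ is Riemannian or pseudo-Riemannian); and when $\varepsilon=-1$, $(\mathcal J_{\lambda,J},\mathcal G_g)$ is a generalized almost Norden structure. The fundamental tensor of $(\mathcal J_{\lambda,J},\mathcal G_g)$ is $$\Phi_{\mathcal J_{\lambda,J}}(X+\xi,Y+\eta)=\phi(X,Y)-\lambda\,\phi(\sharp_\phi\xi,\sharp_\phi\eta)$$ for all $X,Y\in\mathfrak X(M)$, $\xi,\eta\in\Lambda^1(M)$.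
   Context: An $(\alpha,\varepsilon)$-metric manifold $(M,J,g)$, $\alpha,\varepsilon\in\{+1,-1\}$, is a smooth manifold with a Riemannian or pseudo-Riemannian (i.e. nondegenerate, not positive definite) metric $g$ and an $\mathfrak F(M)$-linear $J\colon\mathfrak X(M)\to\mathfrak X(M)$ with $J^2=\alpha Id$ and $g(JX,JY)=\varepsilon g(X,Y)$ for all $X,Y$. $\mathfrak F(M)$, $\mathfrak X(M)$, $\Lambda^1(M)$ denote smooth functions, vector fields, 1-forms; sections of $\mathbb TM$ are written $X+\xi$. For a nondegenerate bilinear form $b$ on $M$: $(\flat_bX)(Y)=b(X,Y)$, $\sharp_b=\flat_b^{-1}$. $(J^*\xi)(X)=\xi(JX)$. Matrix notation: $\begin{pmatrix}H&\sigma\\ \tau&K\end{pmatrix}(X+\xi)=(HX+\sigma\xi)+(\tau X+K\xi)$. $\mathcal G_g(X+\xi,Y+\eta)=g(X,Y)+g(\sharp_g\xi,\sharp_g\eta)$. Compatible means: there is $\delta\in\{+1,-1\}$ with $\mathcal G(\mathcal Ku,\mathcal Kv)=\delta\,\mathcal G(u,v)$ for all sections $u,v$. For an $\mathfrak F(M)$-linear endomorphism $\mathcal J$ of $\Gamma(\mathbb TM)$ with $\mathcal J^2=-Id$ (generalized almost complex structure), $(\mathcal J,\mathcal G)$ is generalized almost Hermitian (resp. indefinite almost Hermitian) if $\delta=+1$ and $\mathcal G$ is Riemannian (resp. pseudo-Riemannian), and generalized almost Norden if $\delta=-1$. The fundamental tensor is $\Phi_{\mathcal J}(u,v)=\mathcal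 G(\mathcal Ju,v)$ (here with $\mathcal G=\mathcal G_g$). *)

theory Defs
  imports "HOL-Analysis.Analysis" "HOL-Library.Function_Algebras"
begin

text \<open>
  The manifold is a type \<open>'m\<close> (Hausdorff, second countable) with a smooth atlas modelled on a
  Euclidean space \<open>'e\<close>, so its dimension is \<open>DIM('e)\<close>. Tensor fields are rendered as multilinear
  maps over the ring of smooth functions: vector fields are the derivations of that ring, and
  1-forms the linear functionals on the module of vector fields. The algebraic operations on
  functions are the pointwise ones.
\<close>

subsection \<open>Smooth manifolds\<close>

text \<open>Both predicates are meant for open sets \<open>S\<close>.\<close>

primrec Ck_on :: "nat \<Rightarrow> 'a::euclidean_space set \<Rightarrow> ('a \<Rightarrow> 'b::real_normed_vector) \<Rightarrow> bool" where
  "Ck_on 0 S f \<longleftrightarrow> continuous_on S f"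
| "Ck_on (Suc k) S f \<longleftrightarrow> (\<forall>x\<in>S. f differentiable (at x)) \<and>
     (\<forall>v. Ck_on k S (\<lambda>x. frechet_derivative f (at x) v))"

definition smooth_on :: "'a::euclidean_space set \<Rightarrow> ('a \<Rightarrow> 'b::real_normed_vector) \<Rightarrow> bool" where
  "smooth_on S f \<longleftrightarrow> (\<forall>k. Ck_on k S f)"

text \<open>A chart is a pair of a domain and a map, the latter being relevant on the domain only.\<close>

type_synonym ('m, 'e) chart = "'m set \<times> ('m \<Rightarrow> 'e)"

definition is_chart :: "('m::topological_space, 'e::euclidean_space) chart \<Rightarrow> bool" where
  "is_chart c \<longleftrightarrow> (case c of (U, x) \<Rightarrow>
     open U \<and> open (x ` U) \<and> (\<exists>y. homeomorphism U (x ` U) x y))"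

definition smooth_atlas :: "('m::topological_space, 'e::euclidean_space) chart set \<Rightarrow> bool" where
  "smooth_atlas A \<longleftrightarrow>
     (\<forall>c\<in>A. is_chart c) \<and>
     (\<Union>c\<in>A. fst c) = UNIV \<and>
     (\<forall>(U, x)\<in>A. \<forall>(V, y)\<in>A. smooth_on (x ` (U \<inter> V)) (y \<circ> inv_into U x))"

type_synonym 'm sfun = "'m \<Rightarrow> real"
type_synonym 'm vfield = "'m sfun \<Rightarrow> 'm sfun"
type_synonym 'm form = "'m vfield \<Rightarrow> 'm sfun"

definition smooth_functions :: "('m::topological_space, 'e::euclidean_space) chart set \<Rightarrow> 'm sfun set" where
  "smooth_functions A = {f. \<forall>(U, x)\<in>A. smooth_on (x ` U) (f \<circ> inv_into U x)}"

text \<open>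
  The action of a function on a vector field (a map on functions) or on a 1-form (a map on
  vector fields).
\<close>

definition fmult :: "'m sfun \<Rightarrow> ('c \<Rightarrow> 'm sfun) \<Rightarrow> ('c \<Rightarrow> 'm sfun)" where
  "fmult f T = (\<lambda>x. f * T x)"

text \<open>
  In the next two definitions the maps are set to 0 outside their mathematical domain, so that
  HOL equality is equality of vector fields and of 1-forms.
\<close>

definition vector_fields :: "('m::topological_space, 'e::euclidean_space) chart set \<Rightarrow> 'm vfield set" where
  "vector_fields A = {X.
     (\<forall>f\<in>smooth_functions A. X f \<in> smooth_functions A) \<and>
     (\<forall>f. f \<notin> smooth_functions A \<longrightarrow> X f = 0) \<and>
     (\<forall>f\<in>smooth_functions A. \<forall>h\<in>smooth_functions A. X (f + h) = X f + X h) \<and>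
     (\<forall>(c::real). \<forall>f\<in>smooth_functions A. X ((\<lambda>_. c) * f) = (\<lambda>_. c) * X f) \<and>
     (\<forall>f\<in>smooth_functions A. \<forall>h\<in>smooth_functions A. X (f * h) = X f * h + f * X h)}"

definition one_forms :: "('m::topological_space, 'e::euclidean_space) chart set \<Rightarrow> 'm form set" where
  "one_forms A = {\<xi>.
     (\<forall>X\<in>vector_fields A. \<xi> X \<in> smooth_functions A) \<and>
     (\<forall>X. X \<notin> vector_fields A \<longrightarrow> \<xi> X = 0) \<and>
     (\<forall>X\<in>vector_fields A. \<forall>Y\<in>vector_fields A. \<xi> (X + Y) = \<xi> X + \<xi> Y) \<and>
     (\<forall>f\<in>smooth_functions A. \<forall>X\<in>vector_fields A. \<xi> (fmult f X) = f * \<xi> X)}"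

text \<open>
  The value at \<open>p\<close> of a vector field (as a derivation at \<open>p\<close>), respectively of a 1-form, is zero.
\<close>

definition zero_at :: "'m \<Rightarrow> ('c \<Rightarrow> 'm sfun) \<Rightarrow> bool" where
  "zero_at p T \<longleftrightarrow> (\<forall>x. T x p = 0)"


subsection \<open>Endomorphisms and metrics\<close>

text \<open>
  The following notions are needed both for vector fields and for sections of the generalized
  tangent bundle. Hence they take as parameters the ring \<open>F\<close> of smooth functions, the module
  \<open>S\<close> of sections, its scalar multiplication \<open>act\<close>, and the predicate \<open>zer\<close> saying that a
  section has value zero at a point.
\<close>

definition module_endo ::
  "'m sfun set \<Rightarrow> 's::plus set \<Rightarrow> ('m sfun \<Rightarrow> 's \<Rightarrow> 's) \<Rightarrow> ('s \<Rightarrow> 's) \<Rightarrow> bool" where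
  "module_endo F S act T \<longleftrightarrow>
     (\<forall>u\<in>S. T u \<in> S) \<and>
     (\<forall>u\<in>S. \<forall>v\<in>S. T (u + v) = T u + T v) \<and>
     (\<forall>f\<in>F. \<forall>u\<in>S. T (act f u) = act f (T u))"

definition bilinear_form ::
  "'m sfun set \<Rightarrow> 's::plus set \<Rightarrow> ('m sfun \<Rightarrow> 's \<Rightarrow> 's) \<Rightarrow> ('s \<Rightarrow> 's \<Rightarrow> 'm sfun) \<Rightarrow> bool" where
  "bilinear_form F S act b \<longleftrightarrow>
     (\<forall>u\<in>S. \<forall>v\<in>S. b u v \<in> F) \<and>
     (\<forall>u\<in>S. \<forall>v\<in>S. \<forall>w\<in>S. b (u + v) w = b u w + b v w \<and> b w (u + v) = b w u + b w v) \<and>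
     (\<forall>f\<in>F. \<forall>u\<in>S. \<forall>v\<in>S. b (act f u) v = f * b u v \<and> b u (act f v) = f * b u v)"

text \<open>
  By multilinearity over the smooth functions, \<open>b u v p\<close> depends only on the values of \<open>u\<close> and
  \<open>v\<close> at \<open>p\<close>, and each vector of the fibre at \<open>p\<close> is the value of a global section. So the
  next two notions are nondegeneracy and positive definiteness of the bilinear form induced by
  \<open>b\<close> on every fibre.
\<close>

definition nondegenerate ::
  "'s set \<Rightarrow> ('m \<Rightarrow> 's \<Rightarrow> bool) \<Rightarrow> ('s \<Rightarrow> 's \<Rightarrow> 'm sfun) \<Rightarrow> bool" where
  "nondegenerate S zer b \<longleftrightarrow> (\<forall>p. \<forall>u\<in>S. (\<forall>v\<in>S. b u v p = 0) \<longrightarrow> zer p u)"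

definition positive_definite ::
  "'s set \<Rightarrow> ('m \<Rightarrow> 's \<Rightarrow> bool) \<Rightarrow> ('s \<Rightarrow> 's \<Rightarrow> 'm sfun) \<Rightarrow> bool" where
  "positive_definite S zer b \<longleftrightarrow> (\<forall>p. \<forall>u\<in>S. \<not> zer p u \<longrightarrow> b u u p > 0)"

definition is_metric ::
  "'m sfun set \<Rightarrow> 's::plus set \<Rightarrow> ('m sfun \<Rightarrow> 's \<Rightarrow> 's) \<Rightarrow> ('m \<Rightarrow> 's \<Rightarrow> bool) \<Rightarrow>
    ('s \<Rightarrow> 's \<Rightarrow> 'm sfun) \<Rightarrow> bool" where
  "is_metric F S act zer b \<longleftrightarrow>
     bilinear_form F S act b \<and> (\<forall>u\<in>S. \<forall>v\<in>S. b u v = b v u) \<and> nondegenerate S zer b"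

definition riemannian ::
  "('m::topological_space, 'e::euclidean_space) chart set \<Rightarrow> ('m vfield \<Rightarrow> 'm vfield \<Rightarrow> 'm sfun) \<Rightarrow> bool" where
  "riemannian A g \<longleftrightarrow>
     is_metric (smooth_functions A) (vector_fields A) fmult zero_at g \<and>
     positive_definite (vector_fields A) zero_at g"

definition pseudo_riemannian ::
  "('m::topological_space, 'e::euclidean_space) chart set \<Rightarrow> ('m vfield \<Rightarrow> 'm vfield \<Rightarrow> 'm sfun) \<Rightarrow> bool" where
  "pseudo_riemannian A g \<longleftrightarrow>
     is_metric (smooth_functions A) (vector_fields A) fmult zero_at g \<and>
     \<not> positive_definite (vector_fields A) zero_at g"

definition metric_manifold ::
  "real \<Rightarrow> real \<Rightarrow> ('m::{t2_space,second_countable_topology}, 'e::euclidean_space) chart set \<Rightarrow>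
    ('m vfield \<Rightarrow> 'm vfield) \<Rightarrow> ('m vfield \<Rightarrow> 'm vfield \<Rightarrow> 'm sfun) \<Rightarrow> bool" where
  "metric_manifold \<alpha> \<epsilon> A J g \<longleftrightarrow>
     \<alpha> \<in> {1, -1} \<and> \<epsilon> \<in> {1, -1} \<and>
     smooth_atlas A \<and>
     (riemannian A g \<or> pseudo_riemannian A g) \<and>
     module_endo (smooth_functions A) (vector_fields A) fmult J \<and>
     (\<forall>X\<in>vector_fields A. J (J X) = fmult (\<lambda>_. \<alpha>) X) \<and>
     (\<forall>X\<in>vector_fields A. \<forall>Y\<in>vector_fields A. g (J X) (J Y) = (\<lambda>_. \<epsilon>) * g X Y)"

definition fundamental_tensor :: "('s \<Rightarrow> 's) \<Rightarrow> ('s \<Rightarrow> 's \<Rightarrow> 'm sfun) \<Rightarrow> 's \<Rightarrow> 's \<Rightarrow> 'm sfun" where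
  "fundamental_tensor J b u v = b (J u) v"

definition flat ::
  "('m::topological_space, 'e::euclidean_space) chart set \<Rightarrow> ('m vfield \<Rightarrow> 'm vfield \<Rightarrow> 'm sfun) \<Rightarrow>
    'm vfield \<Rightarrow> 'm form" where
  "flat A b X = (\<lambda>Y. if Y \<in> vector_fields A then b X Y else 0)"

text \<open>
  For nondegenerate \<open>b\<close> the map \<open>flat A b\<close> is a bijection from vector fields to 1-forms, and
  this is its inverse.
\<close>

definition sharp ::
  "('m::topological_space, 'e::euclidean_space) chart set \<Rightarrow> ('m vfield \<Rightarrow> 'm vfield \<Rightarrow> 'm sfun) \<Rightarrow>
    'm form \<Rightarrow> 'm vfield" where
  "sharp A b = inv_into (vector_fields A) (flat A b)"

definition dual_map ::
  "('m::topological_space, 'e::euclidean_space) chart set \<Rightarrow> ('m vfield \<Rightarrow> 'm vfield) \<Rightarrow>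
    'm form \<Rightarrow> 'm form" where
  "dual_map A J \<xi> = (\<lambda>X. if X \<in> vector_fields A then \<xi> (J X) else 0)"


subsection \<open>The generalized tangent bundle\<close>

text \<open>The section written \<open>X + \<xi>\<close> in the mathematical notation is the pair \<open>(X, \<xi>)\<close>.\<close>

type_synonym 'm gsection = "'m vfield \<times> 'm form"

definition gsections :: "('m::topological_space, 'e::euclidean_space) chart set \<Rightarrow> 'm gsection set" where
  "gsections A = vector_fields A \<times> one_forms A"

definition gmult :: "'m sfun \<Rightarrow> 'm gsection \<Rightarrow> 'm gsection" where
  "gmult f u = (fmult f (fst u), fmult f (snd u))"

definition gzero_at :: "'m \<Rightarrow> 'm gsection \<Rightarrow> bool" where
  "gzero_at p u \<longleftrightarrow> zero_at p (fst u) \<and> zero_at p (snd u)"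

definition gmatrix ::
  "('m vfield \<Rightarrow> 'm vfield) \<Rightarrow> ('m form \<Rightarrow> 'm vfield) \<Rightarrow> ('m vfield \<Rightarrow> 'm form) \<Rightarrow> ('m form \<Rightarrow> 'm form) \<Rightarrow>
    'm gsection \<Rightarrow> 'm gsection" where
  "gmatrix H \<sigma> \<tau> K u = (H (fst u) + \<sigma> (snd u), \<tau> (fst u) + K (snd u))"

definition generalized_metric ::
  "('m::topological_space, 'e::euclidean_space) chart set \<Rightarrow> ('m gsection \<Rightarrow> 'm gsection \<Rightarrow> 'm sfun) \<Rightarrow> bool" where
  "generalized_metric A G \<longleftrightarrow>
     is_metric (smooth_functions A) (gsections A) gmult gzero_at G"

definition generalized_riemannian ::
  "('m::topological_space, 'e::euclidean_space) chart set \<Rightarrow> ('m gsection \<Rightarrow> 'm gsection \<Rightarrow> 'm sfun) \<Rightarrow> bool" where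
  "generalized_riemannian A G \<longleftrightarrow>
     generalized_metric A G \<and> positive_definite (gsections A) gzero_at G"

definition generalized_pseudo_riemannian ::
  "('m::topological_space, 'e::euclidean_space) chart set \<Rightarrow> ('m gsection \<Rightarrow> 'm gsection \<Rightarrow> 'm sfun) \<Rightarrow> bool" where
  "generalized_pseudo_riemannian A G \<longleftrightarrow>
     generalized_metric A G \<and> \<not> positive_definite (gsections A) gzero_at G"

definition induced_metric ::
  "('m::topological_space, 'e::euclidean_space) chart set \<Rightarrow> ('m vfield \<Rightarrow> 'm vfield \<Rightarrow> 'm sfun) \<Rightarrow>
    'm gsection \<Rightarrow> 'm gsection \<Rightarrow> 'm sfun" where
  "induced_metric A g u v =
     g (fst u) (fst v) + g (sharp A g (snd u)) (sharp A g (snd v))"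

definition compatible_with_sign ::
  "real \<Rightarrow> ('m::topological_space, 'e::euclidean_space) chart set \<Rightarrow> ('m gsection \<Rightarrow> 'm gsection) \<Rightarrow>
    ('m gsection \<Rightarrow> 'm gsection \<Rightarrow> 'm sfun) \<Rightarrow> bool" where
  "compatible_with_sign \<delta> A K G \<longleftrightarrow>
     (\<forall>u\<in>gsections A. \<forall>v\<in>gsections A. G (K u) (K v) = (\<lambda>_. \<delta>) * G u v)"

definition compatible ::
  "('m::topological_space, 'e::euclidean_space) chart set \<Rightarrow> ('m gsection \<Rightarrow> 'm gsection) \<Rightarrow>
    ('m gsection \<Rightarrow> 'm gsection \<Rightarrow> 'm sfun) \<Rightarrow> bool" where
  "compatible A K G \<longleftrightarrow> (\<exists>\<delta>\<in>{1, -1}. compatible_with_sign \<delta> A K G)"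

definition generalized_almost_complex ::
  "('m::topological_space, 'e::euclidean_space) chart set \<Rightarrow> ('m gsection \<Rightarrow> 'm gsection) \<Rightarrow> bool" where
  "generalized_almost_complex A K \<longleftrightarrow>
     module_endo (smooth_functions A) (gsections A) gmult K \<and>
     (\<forall>u\<in>gsections A. K (K u) = - u)"

definition generalized_almost_hermitian ::
  "('m::topological_space, 'e::euclidean_space) chart set \<Rightarrow> ('m gsection \<Rightarrow> 'm gsection) \<Rightarrow>
    ('m gsection \<Rightarrow> 'm gsection \<Rightarrow> 'm sfun) \<Rightarrow> bool" where
  "generalized_almost_hermitian A K G \<longleftrightarrow>
     generalized_almost_complex A K \<and> generalized_riemannian A G \<and> compatible_with_sign 1 A K G"

definition generalized_indefinite_almost_hermitian ::
  "('m::topological_space, 'e::euclidean_space) chart set \<Rightarrow> ('m gsection \<Rightarrow> 'm gsection) \<Rightarrow>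
    ('m gsection \<Rightarrow> 'm gsection \<Rightarrow> 'm sfun) \<Rightarrow> bool" where
  "generalized_indefinite_almost_hermitian A K G \<longleftrightarrow>
     generalized_almost_complex A K \<and> generalized_pseudo_riemannian A G \<and> compatible_with_sign 1 A K G"

definition generalized_almost_norden ::
  "('m::topological_space, 'e::euclidean_space) chart set \<Rightarrow> ('m gsection \<Rightarrow> 'm gsection) \<Rightarrow>
    ('m gsection \<Rightarrow> 'm gsection \<Rightarrow> 'm sfun) \<Rightarrow> bool" where
  "generalized_almost_norden A K G \<longleftrightarrow>
     generalized_almost_complex A K \<and> generalized_metric A G \<and> compatible_with_sign (-1) A K G"

definition diag_structure ::
  "('m::topological_space, 'e::euclidean_space) chart set \<Rightarrow> real \<Rightarrow> ('m vfield \<Rightarrow> 'm vfield) \<Rightarrow>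
    'm gsection \<Rightarrow> 'm gsection" where
  "diag_structure A l J = gmatrix J 0 0 (\<lambda>\<xi>. fmult (\<lambda>_. l) (dual_map A J \<xi>))"

end

theory Submission
  imports Defs "Jordan_Normal_Form.Determinant"
begin

text \<open>
  Everything reduces to the musical isomorphisms: \<open>\<sharp>\<^sub>g (J\<^sup>* \<xi>) = - \<epsilon> J \<sharp>\<^sub>g \<xi>\<close> and
  \<open>\<sharp>\<^sub>\<phi> \<xi> = - J \<sharp>\<^sub>g \<xi>\<close>, from which compatibility and the formula for the fundamental tensor
  follow by direct computation. The substantial point is that \<open>\<flat>\<^sub>g\<close> is onto the 1-forms and that
  values at a point depend only on the value of the argument there. By Hadamard's lemma
  every derivation is, after multiplication by a cut-off function, a combination of cut-off
  coordinate fields. Hence 1-forms act pointwise, and Cramer's rule for the Gram matrix of such a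
  frame gives for every point \<open>p\<close> a vector field \<open>W\<close> and a function \<open>D\<close> with \<open>D p \<noteq> 0\<close> and
  \<open>g W Y = D * \<xi> Y\<close> for all \<open>Y\<close>. The quotients \<open>W / D\<close> agree where they are defined, because \<open>g\<close>
  is nondegenerate, and define \<open>\<sharp>\<^sub>g \<xi>\<close>.
\<close>

no_notation scalar_prod (infix \<open>\<bullet>\<close> 70)

subsection \<open>Calculus of smooth functions\<close>

text \<open>Vector fields are derivations of the ring of global functions, so they cannot simply be
  restricted to a chart: every local construction has to be made from global objects that were cut
  off, and each cut-off leaves a factor that is guaranteed to be nonzero only near the point
  considered. Such factors cannot be divided out inside the ring of smooth functions. This is why
  the local results have the shape "denominator times wanted object", why Cramer's rule enters
  through the adjugate matrix, and why division happens only at the very end, pointwise and by real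
  numbers. \<open>sharp\<close> is an inverse chosen by \<open>inv_into\<close>, so the values of
  the induced metric on 1-forms can be computed only once \<open>flat\<close> is known to be
  bijective. This is why the whole analytic part precedes the short algebra of the diagonal
  structure.\<close>

lemma Ck_on_Suc_has_derivative:
  "Ck_on (Suc k) S f \<Longrightarrow> x \<in> S \<Longrightarrow> (f has_derivative frechet_derivative f (at x)) (at x)"
  by (simp add: frechet_derivative_works)

text \<open>Openness is essential: \<open>frechet_derivative\<close> at a point depends on the germ
  of the function there, not only on its values on \<open>S\<close>.\<close>

lemma Ck_on_cong:
  assumes "open S" "\<And>x. x \<in> S \<Longrightarrow> f x = g x" "Ck_on k S f"
  shows "Ck_on k S g"
  using assms(2,3)
proof (induction k arbitrary: f g)
  case 0
  then show ?case by (simp cong: continuous_on_cong)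
next
  case (Suc k)
  have g': "(g has_derivative frechet_derivative f (at x)) (at x)" if "x \<in> S" for x
    by (rule has_derivative_transform_within_open[OF
          Ck_on_Suc_has_derivative[OF Suc.prems(2) that] assms(1) that]) (rule Suc.prems(1))
  have "Ck_on k S (\<lambda>x. frechet_derivative g (at x) v)" for v
    by (rule Suc.IH[of "\<lambda>x. frechet_derivative f (at x) v"])
       (use Suc.prems(2) frechet_derivative_at[OF g'] in auto)
  then show ?case
    using g' by (auto simp: differentiable_def)
qed

text \<open>Lets an explicit formula \<open>f'\<close> replace the chosen
  \<open>frechet_derivative\<close>. The closure rules below use it to turn a differentiation rule
  into an induction on \<open>k\<close>.\<close>

lemma Ck_on_has_derivativeI:
  assumes "open S" "\<And>x. x \<in> S \<Longrightarrow> (f has_derivative f' x) (at x)"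
    and "\<And>v. Ck_on k S (\<lambda>x. f' x v)"
  shows "Ck_on (Suc k) S f"
proof -
  have "Ck_on k S (\<lambda>x. frechet_derivative f (at x) v)" for v
    by (rule Ck_on_cong[OF assms(1) _ assms(3)]) (use frechet_derivative_at[OF assms(2)] in auto)
  then show ?thesis
    using assms(2) by (auto simp: differentiable_def)
qed

lemma Ck_on_SucD: "Ck_on (Suc k) S f \<Longrightarrow> Ck_on k S f"
proof (induction k arbitrary: f)
  case 0
  then show ?case
    by (auto intro!: continuous_at_imp_continuous_on differentiable_imp_continuous_within)
next
  case (Suc k)
  then show ?case by (metis Ck_on.simps(2))
qed

lemma Ck_on_imp_continuous_on: "Ck_on k S f \<Longrightarrow> continuous_on S f"
  by (induction k) (use Ck_on_SucD in auto)

lemma Ck_on_subset: "Ck_on k T f \<Longrightarrow> S \<subseteq> T \<Longrightarrow> Ck_on k S f"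
  by (induction k arbitrary: f) (auto intro: continuous_on_subset)

lemma Ck_on_local:
  assumes "\<And>x. x \<in> S \<Longrightarrow> \<exists>T. open T \<and> x \<in> T \<and> Ck_on k T f"
  shows "Ck_on k S f"
  using assms
proof (induction k arbitrary: f)
  case 0
  show ?case
    unfolding Ck_on.simps
  proof (intro continuous_at_imp_continuous_on ballI)
    fix x assume "x \<in> S"
    then obtain T where "open T" "x \<in> T" "continuous_on T f"
      using 0 by force
    then show "continuous (at x) f"
      by (simp add: continuous_on_eq_continuous_at)
  qed
next
  case (Suc k)
  show ?case
    unfolding Ck_on.simps
  proof (intro conjI ballI allI)
    show "f differentiable at x" if "x \<in> S" for x
      using Suc.prems[OF that] by auto
    show "Ck_on k S (\<lambda>x. frechet_derivative f (at x) v)" for v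
      using Suc.prems by (intro Suc.IH) (metis Ck_on.simps(2))
  qed
qed

lemma Ck_on_const: "open S \<Longrightarrow> Ck_on k S (\<lambda>_. c)"
  by (induction k arbitrary: c) (auto simp: frechet_derivative_const)

lemma Ck_on_bounded_linear:
  assumes "open S" "bounded_linear f"
  shows "Ck_on k S f"
proof (cases k)
  case 0
  then show ?thesis
    using assms by (simp add: linear_continuous_on)
next
  case (Suc m)
  have "Ck_on (Suc m) S f"
    using assms by (intro Ck_on_has_derivativeI[where f'="\<lambda>_. f"] Ck_on_const
        bounded_linear_imp_has_derivative)
  then show ?thesis by (simp only: Suc)
qed

lemma Ck_on_add:
  assumes "open S" "Ck_on k S f" "Ck_on k S g"
  shows "Ck_on k S (\<lambda>x. f x + g x)"
  using assms(2,3)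
proof (induction k arbitrary: f g)
  case 0
  then show ?case by (auto intro: continuous_intros)
next
  case (Suc k)
  show ?case
  proof (rule Ck_on_has_derivativeI[OF assms(1)])
    show "((\<lambda>x. f x + g x) has_derivative
        (\<lambda>v. frechet_derivative f (at x) v + frechet_derivative g (at x) v)) (at x)"
      if "x \<in> S" for x
      using Suc.prems that by (intro has_derivative_add Ck_on_Suc_has_derivative)
  qed (use Suc in auto)
qed

lemma Ck_on_mult:
  fixes f g :: "'a::euclidean_space \<Rightarrow> real"
  assumes "open S" "Ck_on k S f" "Ck_on k S g"
  shows "Ck_on k S (\<lambda>x. f x * g x)"
  using assms(2,3)
proof (induction k arbitrary: f g)
  case 0
  then show ?case by (auto intro: continuous_intros)
next
  case (Suc k)
  show ?case
  proof (rule Ck_on_has_derivativeI[OF assms(1)])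
    show "((\<lambda>x. f x * g x) has_derivative
        (\<lambda>v. f x * frechet_derivative g (at x) v + frechet_derivative f (at x) v * g x)) (at x)"
      if "x \<in> S" for x
      using Suc.prems that by (intro has_derivative_mult Ck_on_Suc_has_derivative)
    show "Ck_on k S (\<lambda>x. f x * frechet_derivative g (at x) v + frechet_derivative f (at x) v * g x)"
      for v
      using Suc.prems Ck_on_SucD[OF Suc.prems(1)] Ck_on_SucD[OF Suc.prems(2)]
      by (intro Ck_on_add[OF assms(1)] Suc.IH) auto
  qed
qed

lemma Ck_on_sum:
  "open S \<Longrightarrow> (\<And>i. i \<in> I \<Longrightarrow> Ck_on k S (f i)) \<Longrightarrow> Ck_on k S (\<lambda>x. \<Sum>i\<in>I. f i x)"
  by (induction I rule: infinite_finite_induct) (auto intro: Ck_on_const Ck_on_add)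

text \<open>The derivative of 1/f contains 1/f again, which the induction hypothesis covers because
  \<open>f\<close> is also of the lower order.\<close>

lemma Ck_on_inverse:
  fixes f :: "'a::euclidean_space \<Rightarrow> real"
  assumes "open S" "Ck_on k S f" "\<And>x. x \<in> S \<Longrightarrow> f x \<noteq> 0"
  shows "Ck_on k S (\<lambda>x. inverse (f x))"
  using assms(2,3)
proof (induction k arbitrary: f)
  case 0
  then show ?case by (auto intro: continuous_intros)
next
  case (Suc k)
  show ?case
  proof (rule Ck_on_has_derivativeI[OF assms(1)])
    show "((\<lambda>x. inverse (f x)) has_derivative
        (\<lambda>v. - 1 * (inverse (f x) * frechet_derivative f (at x) v * inverse (f x)))) (at x)"
      if "x \<in> S" for x
      using Ck_on_Suc_has_derivative[OF Suc.prems(1) that] Suc.prems(2)[OF that]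
      by (auto intro: has_derivative_inverse)
    show "Ck_on k S (\<lambda>x. - 1 * (inverse (f x) * frechet_derivative f (at x) v * inverse (f x)))"
      for v
      using Suc.prems Ck_on_SucD[OF Suc.prems(1)]
      by (intro Ck_on_mult[OF assms(1)] Ck_on_const[OF assms(1)] Suc.IH) auto
  qed
qed

lemma Ck_on_inner_const:
  assumes "open S" "Ck_on k S f"
  shows "Ck_on k S (\<lambda>x. f x \<bullet> b)"
  using assms(2)
proof (induction k arbitrary: f)
  case 0
  then show ?case by (auto intro: continuous_intros)
next
  case (Suc k)
  show ?case
    by (rule Ck_on_has_derivativeI[OF assms(1) has_derivative_inner_left[OF
            Ck_on_Suc_has_derivative[OF Suc.prems]]]) (use Suc in auto)
qed

text \<open>The chain rule applies the derivative of \<open>f\<close> to a vector that varies with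
  the point. Expanding this vector in the basis leaves a finite sum of products of directional
  derivatives in fixed directions, which are again compositions with \<open>g\<close>; hence the
  induction generalizes over \<open>f\<close>.\<close>

lemma Ck_on_compose:
  fixes g :: "'a::euclidean_space \<Rightarrow> 'b::euclidean_space" and f :: "'b \<Rightarrow> real"
  assumes "open S" "g ` S \<subseteq> T" "Ck_on k T f" "Ck_on k S g"
  shows "Ck_on k S (\<lambda>x. f (g x))"
  using assms(3,4)
proof (induction k arbitrary: f)
  case 0
  then show ?case
    using assms(2) continuous_on_compose2 by fastforce
next
  case (Suc k)
  have lin: "frechet_derivative f (at (g x)) v
      = (\<Sum>b\<in>Basis. (v \<bullet> b) * frechet_derivative f (at (g x)) b)" if "x \<in> S" for x v
  proof -
    have "linear (frechet_derivative f (at (g x)))"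
      using assms(2) that Ck_on_Suc_has_derivative[OF Suc.prems(1)]
      by (meson has_derivative_linear image_subset_iff)
    then show ?thesis
      by (subst euclidean_representation[symmetric, of v])
         (simp add: linear_sum linear_cmul)
  qed
  show ?case
  proof (rule Ck_on_has_derivativeI[OF assms(1)])
    show "((\<lambda>x. f (g x)) has_derivative
        (\<lambda>v. \<Sum>b\<in>Basis. (frechet_derivative g (at x) v \<bullet> b) * frechet_derivative f (at (g x)) b)) (at x)"
      if "x \<in> S" for x
      using has_derivative_compose[OF Ck_on_Suc_has_derivative[OF Suc.prems(2) that]
        Ck_on_Suc_has_derivative[OF Suc.prems(1)]] that assms(2)
      by (subst lin[OF that, symmetric]) (auto simp: image_subset_iff)
    show "Ck_on k S (\<lambda>x. \<Sum>b\<in>Basis.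
        (frechet_derivative g (at x) v \<bullet> b) * frechet_derivative f (at (g x)) b)" for v
      using Suc.prems Ck_on_SucD[OF Suc.prems(2)]
      by (intro Ck_on_sum[OF assms(1)] Ck_on_mult[OF assms(1)] Ck_on_inner_const[OF assms(1)]
          Suc.IH) auto
  qed
qed

section \<open>A smooth bump function on Euclidean space\<close>

text \<open>The classical flat function exp(-1/t), extended by 0. The polynomial in 1/t is a
  parameter because the enlarged family is closed under differentiation, so smoothness becomes an
  induction over all \<open>p\<close> at once.\<close>

definition exp_flat :: "real poly \<Rightarrow> real \<Rightarrow> real" where
  "exp_flat p t = (if t > 0 then poly p (1 / t) * exp (- (1 / t)) else 0)"

lemma poly_times_exp_tendsto_0: "((\<lambda>t. poly p t * exp (- t)) \<longlongrightarrow> (0::real)) at_top"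
proof -
  have "((\<lambda>t. \<Sum>i\<le>degree p. coeff p i * (t ^ i / exp t)) \<longlongrightarrow> (\<Sum>i\<le>degree p. coeff p i * 0)) at_top"
    by (intro tendsto_intros tendsto_power_div_exp_0)
  then show ?thesis
    by (simp add: poly_altdef sum_divide_distrib exp_minus divide_inverse sum_distrib_right mult.assoc)
qed

text \<open>For t > 0 the product and chain rules give (p - p')(1/t) / t^2 times the exponential;
  \<open>[:0, 0, 1:]\<close> is the polynomial X^2 that accounts for the factor 1/t^2.\<close>

lemma exp_flat_has_derivative:
  "(exp_flat p has_real_derivative exp_flat ([:0, 0, 1:] * (p - pderiv p)) t) (at t)"
proof -
  consider "t > 0" | "t < 0" | "t = 0" by linarith
  then show ?thesis
  proof cases
    case 1
    have "((\<lambda>s. poly p (1 / s) * exp (- (1 / s))) has_real_derivative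
        exp_flat ([:0, 0, 1:] * (p - pderiv p)) t) (at t)"
      using 1 by (auto intro!: derivative_eq_intros poly_DERIV
          simp: exp_flat_def field_simps power2_eq_square)
    then show ?thesis
      by (rule has_field_derivative_transform_within_open[where S="{0<..}"])
        (use 1 in \<open>auto simp: exp_flat_def\<close>)
  next
    case 2
    have "((\<lambda>_. 0) has_real_derivative exp_flat ([:0, 0, 1:] * (p - pderiv p)) t) (at t)"
      using 2 by (simp add: exp_flat_def)
    then show ?thesis
      by (rule has_field_derivative_transform_within_open[where S="{..<0}"])
        (use 2 in \<open>auto simp: exp_flat_def\<close>)
  next
    case 3
    \<comment> \<open>The difference quotient at 0 is \<open>exp_flat p s / s\<close>. Dividing by
      \<open>s\<close> multiplies the polynomial in 1/s by its variable, hence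
      \<open>pCons 0 p\<close>, and the exponential still dominates.\<close>
    have "((\<lambda>s. poly (pCons 0 p) (inverse s) * exp (- inverse s)) \<longlongrightarrow> 0) (at_right 0)"
      by (rule filterlim_compose[OF poly_times_exp_tendsto_0 filterlim_inverse_at_top_right])
    then have "((\<lambda>s. exp_flat p s / s) \<longlongrightarrow> 0) (at_right 0)"
      by (rule Lim_transform_eventually)
        (auto simp: eventually_at_filter exp_flat_def field_simps)
    moreover have "((\<lambda>s. exp_flat p s / s) \<longlongrightarrow> 0) (at_left 0)"
      by (rule Lim_transform_eventually[OF tendsto_const])
        (auto simp: eventually_at_filter exp_flat_def)
    ultimately have "((\<lambda>s. exp_flat p s / s) \<longlongrightarrow> 0) (at 0)"
      by (simp add: filterlim_split_at)
    then show ?thesis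
      using 3 by (simp add: DERIV_def exp_flat_def)
  qed
qed

lemma Ck_on_exp_flat: "Ck_on k UNIV (exp_flat p)"
proof (induction k arbitrary: p)
  case 0
  show ?case
    using exp_flat_has_derivative
    by (auto intro!: continuous_at_imp_continuous_on DERIV_isCont)
next
  case (Suc k)
  show ?case
  proof (rule Ck_on_has_derivativeI)
    show "(exp_flat p has_derivative (\<lambda>v. exp_flat ([:0, 0, 1:] * (p - pderiv p)) t * v)) (at t)" for t
      using exp_flat_has_derivative by (simp add: has_field_derivative_def)
    show "Ck_on k UNIV (\<lambda>t. exp_flat ([:0, 0, 1:] * (p - pderiv p)) t * v)" for v
      by (intro Ck_on_mult Ck_on_const Suc.IH) auto
  qed auto
qed

text \<open>The squared distance is a polynomial in the coordinates, so the function is smooth also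
  at the centre \<open>a\<close>, where the distance is not.\<close>

definition bump :: "'a::euclidean_space \<Rightarrow> real \<Rightarrow> 'a \<Rightarrow> real" where
  "bump a r z = exp_flat 1 (r\<^sup>2 - (dist z a)\<^sup>2)"

lemma bump_nonzero: "0 < r \<Longrightarrow> bump a r z \<noteq> 0 \<longleftrightarrow> z \<in> ball a r"
  by (auto simp: bump_def exp_flat_def dist_commute power_strict_mono
      dest: power2_less_imp_less power_mono[of r])

lemma Ck_on_bump: "Ck_on k UNIV (bump a r)"
proof -
  have "bump a r = (\<lambda>z. exp_flat 1 (r\<^sup>2 + (\<Sum>b\<in>Basis. (- 1) * (((z + - a) \<bullet> b) * ((z + - a) \<bullet> b)))))"
    by (auto simp: bump_def dist_norm power2_norm_eq_inner sum_negf fun_eq_iff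
        euclidean_inner[of "z - a" "z - a" for z])
  moreover have "Ck_on k UNIV \<dots>"
    by (intro Ck_on_compose[OF _ _ Ck_on_exp_flat] Ck_on_add Ck_on_sum Ck_on_mult Ck_on_const
        Ck_on_inner_const Ck_on_bounded_linear[OF _ bounded_linear_ident]) auto
  ultimately show ?thesis by simp
qed

section \<open>Hadamard's lemma\<close>

text \<open>The weight \<open>t ^ n\<close> makes the induction close: each differentiation produces a factor \<open>t\<close>.\<close>

lemma Ck_on_radial_integral:
  fixes F :: "'a::euclidean_space \<Rightarrow> real"
  assumes "open S" "convex S" "q \<in> S" "Ck_on k S F"
  shows "Ck_on k S (\<lambda>x. integral {0..1} (\<lambda>t. t ^ n * F (q + t *\<^sub>R (x - q))))"
  using assms(4)
proof (induction k arbitrary: F n)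
  have seg: "q + t *\<^sub>R (x - q) \<in> S" if "x \<in> S" "0 \<le> t" "t \<le> 1" for x t
    using convexD_alt[OF assms(2) assms(3) that(1)] that by (simp add: algebra_simps)
  have cont: "continuous_on (S \<times> cbox 0 1) (\<lambda>(x, t). t ^ m * G (q + t *\<^sub>R (x - q)))"
    if "continuous_on S G" for G :: "'a \<Rightarrow> real" and m
    unfolding split_def
    by (intro continuous_intros continuous_on_compose2[OF that]) (auto intro: seg)
  {
    case 0
    then show ?case
      using integral_continuous_on_param[OF cont] by (auto simp: cbox_interval)
  next
    case (Suc k)
    let ?F' = "\<lambda>x. frechet_derivative F (at x)"
    have bl: "bounded_linear (?F' x)" if "x \<in> S" for x
      using Ck_on_Suc_has_derivative[OF Suc.prems that] by (rule has_derivative_bounded_linear)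
    \<comment> \<open>The Leibniz rule asks for a jointly continuous family of bounded linear maps,
      so the derivative of the integrand is packaged as a \<open>blinfun\<close>; in finite
      dimension its continuity can be tested on basis vectors. The extra factor \<open>t\<close>
      comes from the inner derivative of \<open>q + t *\<^sub>R (x - q)\<close>.\<close>
    define D where "D = (\<lambda>x t. Blinfun (\<lambda>v. t ^ Suc n * ?F' (q + t *\<^sub>R (x - q)) v))"
    have D: "blinfun_apply (D x t) v = t ^ Suc n * ?F' (q + t *\<^sub>R (x - q)) v"
      if "x \<in> S" "t \<in> cbox 0 1" for x t v
      using that seg unfolding D_def
      by (subst bounded_linear_Blinfun_apply) (auto intro!: bounded_linear_const_mult bl)
    have contD: "continuous_on (S \<times> cbox 0 1) (\<lambda>(x, t). D x t)"
    proof (rule continuous_on_blinfun_componentwise)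
      fix i :: 'a
      have "continuous_on (S \<times> cbox 0 1) (\<lambda>(x, t). t ^ Suc n * ?F' (q + t *\<^sub>R (x - q)) i)"
        using Suc.prems by (intro cont Ck_on_imp_continuous_on) auto
      then show "continuous_on (S \<times> cbox 0 1) (\<lambda>x. blinfun_apply (case x of (x, t) \<Rightarrow> D x t) i)"
        by (rule continuous_on_eq) (use D in auto)
    qed
    show ?case
    proof (rule Ck_on_has_derivativeI[OF assms(1)])
      fix x assume x: "x \<in> S"
      have "((\<lambda>x. integral (cbox 0 1) (\<lambda>t. t ^ n * F (q + t *\<^sub>R (x - q)))) has_derivative
          integral (cbox 0 1) (D x)) (at x within S)"
      proof (rule leibniz_rule[OF _ _ contD x assms(2)])
        fix x' and t :: real assume *: "x' \<in> S" "t \<in> cbox 0 1"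
        have "((\<lambda>x. F (q + t *\<^sub>R (x - q))) has_derivative
            (\<lambda>v. ?F' (q + t *\<^sub>R (x' - q)) (t *\<^sub>R v))) (at x' within S)"
          using * by (intro has_derivative_compose[OF _ Ck_on_Suc_has_derivative[OF Suc.prems]])
             (auto intro!: derivative_eq_intros seg)
        then have "((\<lambda>x. t ^ n * F (q + t *\<^sub>R (x - q))) has_derivative
            (\<lambda>v. t ^ n * ?F' (q + t *\<^sub>R (x' - q)) (t *\<^sub>R v))) (at x' within S)"
          by (rule has_derivative_mult_right)
        moreover have "(\<lambda>v. t ^ n * ?F' (q + t *\<^sub>R (x' - q)) (t *\<^sub>R v)) = blinfun_apply (D x' t)"
          using * seg linear_cmul[OF bounded_linear.linear[OF bl]] by (auto simp: D fun_eq_iff)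
        ultimately show "((\<lambda>x. t ^ n * F (q + t *\<^sub>R (x - q))) has_derivative
            blinfun_apply (D x' t)) (at x' within S)" by simp
      next
        fix x' assume "x' \<in> S"
        then have "continuous_on (cbox 0 1) (\<lambda>t. t ^ n * F (q + t *\<^sub>R (x' - q)))"
          by (intro continuous_intros continuous_on_compose2[OF Ck_on_imp_continuous_on[OF Suc.prems]])
            (auto intro: seg)
        then show "(\<lambda>t. t ^ n * F (q + t *\<^sub>R (x' - q))) integrable_on cbox 0 1"
          by (rule integrable_continuous)
      qed
      moreover have "D x integrable_on cbox 0 1"
      proof (rule integrable_continuous)
        have "continuous_on (cbox 0 1) (\<lambda>t. case (x, t) of (x, t) \<Rightarrow> D x t)"
          by (rule continuous_on_compose2[OF contD]) (use x in \<open>auto intro!: continuous_intros\<close>)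
        then show "continuous_on (cbox 0 1) (D x)" by simp
      qed
      then have "blinfun_apply (integral (cbox 0 1) (D x))
          = (\<lambda>v. integral (cbox 0 1) (\<lambda>t. t ^ Suc n * ?F' (q + t *\<^sub>R (x - q)) v))"
        using x by (auto simp: fun_eq_iff blinfun_apply_integral D intro!: integral_cong)
      ultimately show "((\<lambda>x. integral {0..1} (\<lambda>t. t ^ n * F (q + t *\<^sub>R (x - q)))) has_derivative
          (\<lambda>v. integral {0..1} (\<lambda>t. t ^ Suc n * ?F' (q + t *\<^sub>R (x - q)) v))) (at x)"
        using at_within_open[OF x assms(1)] by (simp add: cbox_interval)
    next
      show "Ck_on k S (\<lambda>x. integral {0..1} (\<lambda>t. t ^ Suc n * ?F' (q + t *\<^sub>R (x - q)) v))" for v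
        using Suc.prems by (intro Suc.IH) auto
    qed
  }
qed

text \<open>Integrate the derivative of \<open>f\<close> along the segment from \<open>q\<close> to
  \<open>x\<close>, which convexity keeps inside \<open>S\<close>, and split the direction
  \<open>x - q\<close> into coordinates. The value of \<open>h b\<close> at \<open>q\<close> is
  recorded because it becomes the coefficient of a derivation at \<open>q\<close>.\<close>

lemma hadamard:
  fixes f :: "'a::euclidean_space \<Rightarrow> real"
  assumes "open S" "convex S" "q \<in> S" "smooth_on S f"
  obtains h where "\<And>b. smooth_on S (h b)"
    and "\<And>b. h b q = frechet_derivative f (at q) b"
    and "\<And>x. x \<in> S \<Longrightarrow> f x = f q + (\<Sum>b\<in>Basis. ((x - q) \<bullet> b) * h b x)"
proof -
  let ?f' = "\<lambda>x. frechet_derivative f (at x)"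
  \<comment> \<open>The factor \<open>t ^ 0\<close> only matches the shape of
    \<open>Ck_on_radial_integral\<close>.\<close>
  define h where "h = (\<lambda>b x. integral {0..1} (\<lambda>t. t ^ 0 * ?f' (q + t *\<^sub>R (x - q)) b))"
  have seg: "q + t *\<^sub>R (x - q) \<in> S" if "x \<in> S" "0 \<le> t" "t \<le> 1" for x t
    using convexD_alt[OF assms(2) assms(3) that(1)] that by (simp add: algebra_simps)
  have f': "Ck_on k S (\<lambda>x. ?f' x b)" for k b
    using assms(4) unfolding smooth_on_def by (metis Ck_on.simps(2))
  have fd: "(f has_derivative ?f' x) (at x)" if "x \<in> S" for x
    using Ck_on_Suc_has_derivative that assms(4) unfolding smooth_on_def by blast
  have "f x = f q + (\<Sum>b\<in>Basis. ((x - q) \<bullet> b) * h b x)" if x: "x \<in> S" for x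
  proof -
    have "((\<lambda>t. ?f' (q + t *\<^sub>R (x - q)) (x - q)) has_integral
        f (q + 1 *\<^sub>R (x - q)) - f (q + 0 *\<^sub>R (x - q))) {0..1}"
    proof (rule fundamental_theorem_of_calculus)
      fix t :: real assume t: "t \<in> {0..1}"
      have "((\<lambda>t. f (q + t *\<^sub>R (x - q))) has_derivative
          (\<lambda>s. ?f' (q + t *\<^sub>R (x - q)) (s *\<^sub>R (x - q)))) (at t within {0..1})"
        using t x by (intro has_derivative_compose[OF _ fd]) (auto intro!: derivative_eq_intros seg)
      then show "((\<lambda>t. f (q + t *\<^sub>R (x - q))) has_vector_derivative
          ?f' (q + t *\<^sub>R (x - q)) (x - q)) (at t within {0..1})"
        using t x linear_cmul[OF has_derivative_linear[OF fd]]
        by (simp add: has_vector_derivative_def seg)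
    qed simp
    then have "f x - f q = integral {0..1} (\<lambda>t. ?f' (q + t *\<^sub>R (x - q)) (x - q))"
      by (simp add: integral_unique)
    also have "\<dots> = integral {0..1} (\<lambda>t. \<Sum>b\<in>Basis. ((x - q) \<bullet> b) * ?f' (q + t *\<^sub>R (x - q)) b)"
    proof (rule integral_cong)
      fix t :: real assume "t \<in> {0..1}"
      then have "linear (?f' (q + t *\<^sub>R (x - q)))"
        using x by (intro has_derivative_linear[OF fd] seg) auto
      then show "?f' (q + t *\<^sub>R (x - q)) (x - q)
          = (\<Sum>b\<in>Basis. ((x - q) \<bullet> b) * ?f' (q + t *\<^sub>R (x - q)) b)"
        by (subst (2) euclidean_representation[symmetric, of "x - q"])
         (simp only: linear_sum linear_cmul real_scaleR_def)
    qed
    also have "\<dots> = (\<Sum>b\<in>Basis. ((x - q) \<bullet> b) * h b x)"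
    proof (subst integral_sum)
      fix b :: 'a
      have "continuous_on {0..1} (\<lambda>t. ?f' (q + t *\<^sub>R (x - q)) b)"
        using x by (intro continuous_on_compose2[OF Ck_on_imp_continuous_on[OF f']])
          (auto intro!: continuous_intros seg)
      then show "(\<lambda>t. ((x - q) \<bullet> b) * ?f' (q + t *\<^sub>R (x - q)) b) integrable_on {0..1}"
        by (intro integrable_continuous_real continuous_intros)
    qed (auto simp: h_def)
    finally show ?thesis by simp
  qed
  moreover have "smooth_on S (h b)" for b
    unfolding smooth_on_def h_def using Ck_on_radial_integral[OF assms(1-3) f'] by blast
  moreover have "h b q = ?f' q b" for b
    by (simp add: h_def)
  ultimately show ?thesis using that by blast
qed

section \<open>Closure properties of smooth maps\<close>

lemma smooth_on_cong:
  "open S \<Longrightarrow> (\<And>x. x \<in> S \<Longrightarrow> f x = g x) \<Longrightarrow> smooth_on S f \<Longrightarrow> smooth_on S g"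
  unfolding smooth_on_def using Ck_on_cong by blast

lemma smooth_on_subset: "smooth_on T f \<Longrightarrow> S \<subseteq> T \<Longrightarrow> smooth_on S f"
  unfolding smooth_on_def using Ck_on_subset by blast

lemma smooth_on_local:
  "(\<And>x. x \<in> S \<Longrightarrow> \<exists>T. open T \<and> x \<in> T \<and> smooth_on T f) \<Longrightarrow> smooth_on S f"
  unfolding smooth_on_def by (metis Ck_on_local)

lemma smooth_on_const: "open S \<Longrightarrow> smooth_on S (\<lambda>_. c)"
  unfolding smooth_on_def using Ck_on_const by blast

lemma smooth_on_add:
  "open S \<Longrightarrow> smooth_on S f \<Longrightarrow> smooth_on S g \<Longrightarrow> smooth_on S (\<lambda>x. f x + g x)"
  unfolding smooth_on_def using Ck_on_add by blast

lemma smooth_on_mult: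
  fixes f g :: "'a::euclidean_space \<Rightarrow> real"
  shows "open S \<Longrightarrow> smooth_on S f \<Longrightarrow> smooth_on S g \<Longrightarrow> smooth_on S (\<lambda>x. f x * g x)"
  unfolding smooth_on_def using Ck_on_mult by blast

lemma smooth_on_inverse:
  fixes f :: "'a::euclidean_space \<Rightarrow> real"
  shows "open S \<Longrightarrow> smooth_on S f \<Longrightarrow> (\<And>x. x \<in> S \<Longrightarrow> f x \<noteq> 0) \<Longrightarrow> smooth_on S (\<lambda>x. inverse (f x))"
  unfolding smooth_on_def using Ck_on_inverse by blast

lemma smooth_on_compose:
  fixes g :: "'a::euclidean_space \<Rightarrow> 'b::euclidean_space" and f :: "'b \<Rightarrow> real"
  shows "open S \<Longrightarrow> g ` S \<subseteq> T \<Longrightarrow> smooth_on T f \<Longrightarrow> smooth_on S g \<Longrightarrow> smooth_on S (\<lambda>x. f (g x))"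
  unfolding smooth_on_def using Ck_on_compose by blast

lemma smooth_on_frechet_derivative:
  "smooth_on S f \<Longrightarrow> smooth_on S (\<lambda>x. frechet_derivative f (at x) v)"
  unfolding smooth_on_def by (metis Ck_on.simps(2))

lemma smooth_on_has_derivative:
  "smooth_on S f \<Longrightarrow> x \<in> S \<Longrightarrow> (f has_derivative frechet_derivative f (at x)) (at x)"
  unfolding smooth_on_def using Ck_on_Suc_has_derivative by blast

lemma smooth_on_imp_continuous_on: "smooth_on S f \<Longrightarrow> continuous_on S f"
  unfolding smooth_on_def using Ck_on_imp_continuous_on by blast

subsection \<open>Charts\<close>

lemma chart_open:
  assumes "smooth_atlas A" "(U, x) \<in> A"
  shows "open U" "open (x ` U)"
  using assms by (auto simp: smooth_atlas_def is_chart_def)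

text \<open>\<open>is_chart\<close> provides some inverse, whereas smoothness is expressed with
  \<open>inv_into\<close>; on the image of the chart the two agree.\<close>

lemma chart_homeomorphism:
  assumes "smooth_atlas A" "(U, x) \<in> A"
  shows "homeomorphism U (x ` U) x (inv_into U x)"
proof -
  obtain y where y: "homeomorphism U (x ` U) x y"
    using assms by (auto simp: smooth_atlas_def is_chart_def)
  then have "inj_on x U"
    by (metis homeomorphism_def inj_on_inverseI)
  then have "inv_into U x z = y z" if "z \<in> x ` U" for z
    using y that by (auto simp: homeomorphism_def)
  with y show ?thesis
    by (auto simp: homeomorphism_def cong: continuous_on_cong image_cong)
qed

lemma chart_inv_into:
  assumes "smooth_atlas A" "(U, x) \<in> A" "q \<in> U"
  shows "inv_into U x (x q) = q"
  using chart_homeomorphism[OF assms(1,2)] assms(3) by (auto simp: homeomorphism_def)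

lemma chart_image_open:
  assumes "smooth_atlas A" "(U, x) \<in> A" "open V" "V \<subseteq> U"
  shows "open (x ` V)"
proof -
  have "x ` V = x ` U \<inter> inv_into U x -` V"
    using assms(4) chart_inv_into[OF assms(1,2)] by force
  moreover have "open \<dots>"
    using chart_homeomorphism[OF assms(1,2)] chart_open[OF assms(1,2)] assms(3)
    by (intro continuous_open_preimage) (auto simp: homeomorphism_def)
  ultimately show ?thesis by simp
qed

lemma smooth_functionsD:
  "f \<in> smooth_functions A \<Longrightarrow> (U, x) \<in> A \<Longrightarrow> smooth_on (x ` U) (f \<circ> inv_into U x)"
  by (auto simp: smooth_functions_def)

lemma smooth_functions_const: "smooth_atlas A \<Longrightarrow> (\<lambda>_. c) \<in> smooth_functions A"
  using chart_open by (auto simp: smooth_functions_def o_def intro!: smooth_on_const)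

lemma smooth_functions_zero: "smooth_atlas A \<Longrightarrow> 0 \<in> smooth_functions A"
  using smooth_functions_const[of A 0] by (simp add: func_zero)

lemma smooth_functions_add:
  "smooth_atlas A \<Longrightarrow> f \<in> smooth_functions A \<Longrightarrow> h \<in> smooth_functions A \<Longrightarrow> f + h \<in> smooth_functions A"
  using chart_open by (force simp: smooth_functions_def o_def intro!: smooth_on_add)

lemma smooth_functions_mult:
  "smooth_atlas A \<Longrightarrow> f \<in> smooth_functions A \<Longrightarrow> h \<in> smooth_functions A \<Longrightarrow> f * h \<in> smooth_functions A"
  using chart_open by (force simp: smooth_functions_def o_def intro!: smooth_on_mult)

lemma smooth_functions_uminus:
  "smooth_atlas A \<Longrightarrow> f \<in> smooth_functions A \<Longrightarrow> - f \<in> smooth_functions A"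
  using smooth_functions_mult[OF _ smooth_functions_const, of A f "- 1"]
  by (simp add: times_fun_def fun_Compl_def)

lemma smooth_functions_sum:
  "smooth_atlas A \<Longrightarrow> (\<And>i. i \<in> I \<Longrightarrow> f i \<in> smooth_functions A) \<Longrightarrow> sum f I \<in> smooth_functions A"
  by (induction I rule: infinite_finite_induct)
     (auto intro: smooth_functions_zero smooth_functions_add)

text \<open>Prepares the gluing of vector fields that are known only as quotients with a denominator
  depending on the point. In a chart the denominator stays nonzero on an open set, where the
  quotient is smooth.\<close>

lemma smooth_functions_local_quotient:
  assumes "smooth_atlas A"
    and "\<And>p. \<exists>u\<in>smooth_functions A. \<exists>D\<in>smooth_functions A.
      D p \<noteq> 0 \<and> (\<forall>q. D q \<noteq> 0 \<longrightarrow> f q = u q / D q)"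
  shows "f \<in> smooth_functions A"
proof -
  have "smooth_on (x ` U) (f \<circ> inv_into U x)" if c: "(U, x) \<in> A" for U x
  proof (rule smooth_on_local)
    fix z assume z: "z \<in> x ` U"
    let ?i = "inv_into U x"
    obtain u D where uD: "u \<in> smooth_functions A" "D \<in> smooth_functions A" "D (?i z) \<noteq> 0"
      "\<And>q. D q \<noteq> 0 \<Longrightarrow> f q = u q / D q"
      using assms(2)[of "?i z"] by blast
    let ?T = "x ` U \<inter> (D \<circ> ?i) -` (- {0})"
    have T: "open ?T"
      using smooth_on_imp_continuous_on[OF smooth_functionsD[OF uD(2) c]] chart_open[OF assms(1) c]
      by (intro continuous_open_preimage) auto
    have "smooth_on ?T (u \<circ> ?i)" "smooth_on ?T (D \<circ> ?i)"
      using smooth_functionsD[OF _ c] uD(1,2) by (blast intro: smooth_on_subset)+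
    moreover from this(2) have "smooth_on ?T (\<lambda>z. inverse ((D \<circ> ?i) z))"
      by (rule smooth_on_inverse[OF T]) auto
    ultimately have "smooth_on ?T (u \<circ> ?i)" "smooth_on ?T (\<lambda>z. inverse ((D \<circ> ?i) z))"
      by blast+
    then have "smooth_on ?T (\<lambda>z. (u \<circ> ?i) z * inverse ((D \<circ> ?i) z))"
      by (rule smooth_on_mult[OF T])
    then have "smooth_on ?T (f \<circ> ?i)"
      by (rule smooth_on_cong[OF T, rotated]) (auto simp: uD(4) divide_inverse)
    then show "\<exists>T. open T \<and> z \<in> T \<and> smooth_on T (f \<circ> ?i)"
      using T z uD(3) by (intro exI[of _ ?T]) auto
  qed
  then show ?thesis by (auto simp: smooth_functions_def)
qed

subsection \<open>Vector fields\<close>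

lemma sum_fun_apply: "(\<Sum>i\<in>I. F i) x = (\<Sum>i\<in>I. F i x)"
  by (induction I rule: infinite_finite_induct) auto

lemma vector_fieldsD:
  assumes "X \<in> vector_fields A"
  shows "f \<in> smooth_functions A \<Longrightarrow> X f \<in> smooth_functions A"
    and "f \<notin> smooth_functions A \<Longrightarrow> X f = 0"
    and "f \<in> smooth_functions A \<Longrightarrow> h \<in> smooth_functions A \<Longrightarrow> X (f + h) = X f + X h"
    and "f \<in> smooth_functions A \<Longrightarrow> X ((\<lambda>_. c) * f) = (\<lambda>_. c) * X f"
    and "f \<in> smooth_functions A \<Longrightarrow> h \<in> smooth_functions A \<Longrightarrow> X (f * h) = X f * h + f * X h"
  using assms by (auto simp: vector_fields_def)

lemma vector_field_zero:
  assumes "smooth_atlas A" "X \<in> vector_fields A"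
  shows "X 0 = 0"
  using vector_fieldsD(3)[OF assms(2) smooth_functions_zero smooth_functions_zero, OF assms(1,1)]
  by simp

lemma vector_field_sum:
  assumes "smooth_atlas A" "X \<in> vector_fields A" "\<And>i. i \<in> I \<Longrightarrow> f i \<in> smooth_functions A"
  shows "X (sum f I) = (\<Sum>i\<in>I. X (f i))"
  using assms(3)
proof (induction I rule: infinite_finite_induct)
  case (insert i I)
  then have "X (f i + sum f I) = X (f i) + X (sum f I)"
    by (intro vector_fieldsD(3)[OF assms(2)] smooth_functions_sum[OF assms(1)]) auto
  moreover have "X (sum f I) = (\<Sum>i\<in>I. X (f i))"
    using insert by auto
  ultimately show ?case
    by (simp only: sum.insert[OF insert.hyps(1,2)])
qed (simp_all add: vector_field_zero[OF assms(1,2)])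

lemma vector_fields_zero: "smooth_atlas A \<Longrightarrow> 0 \<in> vector_fields A"
  by (auto simp: vector_fields_def smooth_functions_zero)

lemma vector_fields_add:
  "smooth_atlas A \<Longrightarrow> X \<in> vector_fields A \<Longrightarrow> Y \<in> vector_fields A \<Longrightarrow> X + Y \<in> vector_fields A"
  unfolding vector_fields_def by (auto simp: smooth_functions_add algebra_simps)

lemma vector_fields_fmult:
  "smooth_atlas A \<Longrightarrow> f \<in> smooth_functions A \<Longrightarrow> X \<in> vector_fields A \<Longrightarrow> fmult f X \<in> vector_fields A"
  unfolding vector_fields_def fmult_def by (auto simp: smooth_functions_mult algebra_simps)

lemma vector_fields_sum:
  "smooth_atlas A \<Longrightarrow> (\<And>i. i \<in> I \<Longrightarrow> X i \<in> vector_fields A) \<Longrightarrow> sum X I \<in> vector_fields A"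
  by (induction I rule: infinite_finite_induct)
     (auto intro: vector_fields_zero vector_fields_add)

lemma fmult_minus_one: "fmult (\<lambda>_. - 1) X = - X"
  by (auto simp: fmult_def fun_eq_iff)

lemma vector_fields_uminus:
  "smooth_atlas A \<Longrightarrow> X \<in> vector_fields A \<Longrightarrow> - X \<in> vector_fields A"
  using vector_fields_fmult[OF _ smooth_functions_const, of A X "- 1"]
  by (simp add: fmult_minus_one)

lemma vector_fields_diff:
  "smooth_atlas A \<Longrightarrow> X \<in> vector_fields A \<Longrightarrow> Y \<in> vector_fields A \<Longrightarrow> X - Y \<in> vector_fields A"
  using vector_fields_add[OF _ _ vector_fields_uminus, of A X Y] by simp

subsection \<open>Local frames\<close>

text \<open>Two radii: the cut-off lives on the ball of radius \<open>r\<close>, while functions to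
  be cut off are smooth on the larger ball. The gap \<open>r < R\<close> makes
  \<open>cball a r\<close> a compact subset of the chart image.\<close>

locale chart_ball =
  fixes A :: "('m::t2_space, 'e::euclidean_space) chart set"
    and U :: "'m set" and x :: "'m \<Rightarrow> 'e" and a :: 'e and r R :: real
  assumes atlas: "smooth_atlas A" and chart: "(U, x) \<in> A"
    and r: "0 < r" "r < R" and ball: "ball a R \<subseteq> x ` U"
begin

abbreviation B :: "'e \<Rightarrow> real" where "B \<equiv> bump a r"

definition bump_ext :: "('e \<Rightarrow> real) \<Rightarrow> 'm sfun" where
  "bump_ext h q = (if q \<in> U then B (x q) * h (x q) else 0)"

lemma B_zero: "z \<notin> ball a R \<Longrightarrow> B z = 0"
  using bump_nonzero[OF r(1), of a z] r(2) by auto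

text \<open>The open sets \<open>ball a R\<close> and \<open>- cball a r\<close> cover the space. On
  the first both factors are smooth, on the second the product vanishes identically.\<close>

lemma smooth_on_bump_mult:
  assumes "smooth_on (ball a R) h"
  shows "smooth_on UNIV (\<lambda>z. B z * h z)"
proof (rule smooth_on_local)
  fix z :: 'e
  show "\<exists>T. open T \<and> z \<in> T \<and> smooth_on T (\<lambda>z. B z * h z)"
  proof (cases "z \<in> ball a R")
    case True
    have "smooth_on (ball a R) B"
      using Ck_on_subset[OF Ck_on_bump] unfolding smooth_on_def by blast
    then show ?thesis
      using True assms by (intro exI[of _ "ball a R"]) (auto intro: smooth_on_mult)
  next
    case False
    have "smooth_on (- cball a r) (\<lambda>z. B z * h z)"
      by (rule smooth_on_cong[OF _ _ smooth_on_const[of _ 0]])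
         (use bump_nonzero[OF r(1), of a] in \<open>force simp: not_le\<close>)+
    then show ?thesis
      using False r by (intro exI[of _ "- cball a r"]) auto
  qed
qed

text \<open>The danger is the boundary of \<open>U\<close> seen from another chart. The compact set
  \<open>K\<close> contains every point where the extension is nonzero, and it is closed because the
  manifold is Hausdorff. So near a point outside \<open>U\<close> the function is 0, and near a
  point of \<open>U\<close> it is a smooth function composed with a transition map.\<close>

lemma smooth_bump_ext:
  assumes "smooth_on (ball a R) h"
  shows "bump_ext h \<in> smooth_functions A"
proof -
  let ?i = "inv_into U x"
  define K where "K = ?i ` cball a r"
  have cb: "cball a r \<subseteq> x ` U"
    using ball r by (auto simp: subset_iff)
  have "compact K"
    unfolding K_def using chart_homeomorphism[OF atlas chart] cb
    by (intro compact_continuous_image) (auto simp: homeomorphism_def intro: continuous_on_subset)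
  then have K: "closed K"
    by (rule compact_imp_closed)
  have zero: "bump_ext h q = 0" if "q \<notin> K" for q
  proof (rule ccontr)
    assume "bump_ext h q \<noteq> 0"
    then have "q \<in> U" "x q \<in> cball a r"
      using bump_nonzero[OF r(1), of a "x q"] by (auto simp: bump_ext_def split: if_splits)
    then show False
      using that chart_inv_into[OF atlas chart] by (force simp: K_def)
  qed
  have "smooth_on (y ` V) (bump_ext h \<circ> inv_into V y)" if c: "(V, y) \<in> A" for V y
  proof (rule smooth_on_local)
    fix z assume z: "z \<in> y ` V"
    let ?j = "inv_into V y"
    have j: "z = y (?j z)" "?j z \<in> V"
      using z by (simp_all add: f_inv_into_f inv_into_into)
    show "\<exists>T. open T \<and> z \<in> T \<and> smooth_on T (bump_ext h \<circ> ?j)"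
    proof (cases "?j z \<in> U")
      case True
      let ?T = "y ` (V \<inter> U)"
      have T: "open ?T"
        using chart_open(1)[OF atlas c] chart_open(1)[OF atlas chart]
        by (intro chart_image_open[OF atlas c]) auto
      have "smooth_on ?T (x \<circ> ?j)"
        using atlas c chart unfolding smooth_atlas_def by fast
      then have "smooth_on ?T (\<lambda>w. (\<lambda>z. B z * h z) ((x \<circ> ?j) w))"
        by (rule smooth_on_compose[OF T, where T=UNIV and f="\<lambda>z. B z * h z", rotated 2])
           (rule subset_UNIV, rule smooth_on_bump_mult[OF assms])
      then have "smooth_on ?T (bump_ext h \<circ> ?j)"
        by (rule smooth_on_cong[OF T, rotated]) (auto simp: bump_ext_def chart_inv_into[OF atlas c])
      moreover have "z \<in> ?T"
        using True j by blast
      ultimately show ?thesis using T by blast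
    next
      case False
      let ?T = "y ` (V - K)"
      have T: "open ?T"
        using chart_open(1)[OF atlas c] K by (intro chart_image_open[OF atlas c]) auto
      have "smooth_on ?T (bump_ext h \<circ> ?j)"
        by (rule smooth_on_cong[OF T, where f="\<lambda>_. 0"])
           (auto simp: zero chart_inv_into[OF atlas c] intro: smooth_on_const T)
      moreover have "K \<subseteq> U"
        using cb by (auto simp: K_def inv_into_into subset_iff)
      then have "z \<in> ?T"
        using False j by blast
      ultimately show ?thesis using T by blast
    qed
  qed
  then show ?thesis by (auto simp: smooth_functions_def)
qed

text \<open>The partial derivative in direction \<open>b\<close>, multiplied by the bump and
  extended by zero, so that it is a derivation of global functions.\<close>

definition coord_field :: "'e \<Rightarrow> 'm vfield" where
  "coord_field b f = (if f \<in> smooth_functions A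
     then bump_ext (\<lambda>z. frechet_derivative (f \<circ> inv_into U x) (at z) b) else 0)"

lemma chart_has_derivative:
  assumes "f \<in> smooth_functions A" "q \<in> U"
  shows "((f \<circ> inv_into U x) has_derivative frechet_derivative (f \<circ> inv_into U x) (at (x q))) (at (x q))"
  using smooth_on_has_derivative[OF smooth_functionsD[OF assms(1) chart]] assms(2) by blast

lemma coord_field_apply:
  "f \<in> smooth_functions A \<Longrightarrow> ((f \<circ> inv_into U x) has_derivative D) (at (x q)) \<Longrightarrow>
     coord_field b f q = (if q \<in> U then B (x q) * D b else 0)"
  using frechet_derivative_at[of "f \<circ> inv_into U x" D "x q"]
  by (auto simp: coord_field_def bump_ext_def)

lemma coord_field_outside: "q \<notin> U \<Longrightarrow> coord_field b f q = 0"
  by (simp add: coord_field_def bump_ext_def)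

text \<open>Inside \<open>U\<close> the laws of a derivation are the rules of differentiation for
  the representatives in the chart; outside \<open>U\<close> all terms vanish.\<close>

lemma coord_field_in_vector_fields: "coord_field b \<in> vector_fields A"
proof -
  let ?i = "inv_into U x"
  let ?D = "\<lambda>f q. frechet_derivative (f \<circ> ?i) (at (x q))"
  have 1: "coord_field b f \<in> smooth_functions A" if "f \<in> smooth_functions A" for f
    using that smooth_on_subset[OF smooth_on_frechet_derivative[OF smooth_functionsD[OF that chart]] ball]
    by (auto simp: coord_field_def intro: smooth_bump_ext)
  have val: "coord_field b f q = B (x q) * ?D f q b"
    if "f \<in> smooth_functions A" "q \<in> U" for f q
    using coord_field_apply[OF that(1) chart_has_derivative[OF that]] that by simp
  have add: "coord_field b (f + h) q = (coord_field b f + coord_field b h) q"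
    if "f \<in> smooth_functions A" "h \<in> smooth_functions A" for f h q
  proof (cases "q \<in> U")
    case True
    have "(((f + h) \<circ> ?i) has_derivative (\<lambda>v. ?D f q v + ?D h q v)) (at (x q))"
      using has_derivative_add[OF chart_has_derivative[OF that(1) True] chart_has_derivative[OF that(2) True]]
      by (simp add: o_def)
    from coord_field_apply[OF smooth_functions_add[OF atlas that] this] show ?thesis
      using True that by (simp add: val algebra_simps)
  qed (simp add: coord_field_outside)
  have mult: "coord_field b (f * h) q = (coord_field b f * h + f * coord_field b h) q"
    if "f \<in> smooth_functions A" "h \<in> smooth_functions A" for f h q
  proof (cases "q \<in> U")
    case True
    have "(((f * h) \<circ> ?i) has_derivative (\<lambda>v. f q * ?D h q v + ?D f q v * h q)) (at (x q))"
      using has_derivative_mult[OF chart_has_derivative[OF that(1) True] chart_has_derivative[OF that(2) True]]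
        True by (simp add: o_def chart_inv_into[OF atlas chart])
    from coord_field_apply[OF smooth_functions_mult[OF atlas that] this] show ?thesis
      using True that by (simp add: val algebra_simps)
  qed (simp add: coord_field_outside)
  have cst: "coord_field b ((\<lambda>_. c) * f) q = ((\<lambda>_. c) * coord_field b f) q"
    if "f \<in> smooth_functions A" for f c q
  proof (cases "q \<in> U")
    case True
    have "((((\<lambda>_. c) * f) \<circ> ?i) has_derivative (\<lambda>v. c * ?D f q v)) (at (x q))"
      using has_derivative_mult_right[OF chart_has_derivative[OF that(1) True], of c]
      by (simp add: o_def)
    from coord_field_apply[OF smooth_functions_mult[OF atlas smooth_functions_const[OF atlas] that] this]
    show ?thesis
      using True that by (simp add: val algebra_simps)
  qed (simp add: coord_field_outside)
  show ?thesis
    unfolding vector_fields_def mem_Collect_eq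
    using 1 add mult cst by (intro conjI ballI allI impI ext) (auto simp: coord_field_def)
qed

abbreviation \<beta> :: "'m sfun" where "\<beta> \<equiv> bump_ext (\<lambda>_. 1)"
abbreviation \<kappa> :: "'e \<Rightarrow> 'm sfun" where "\<kappa> b \<equiv> bump_ext (\<lambda>z. z \<bullet> b)"

lemma smooth_\<beta>: "\<beta> \<in> smooth_functions A"
  by (intro smooth_bump_ext smooth_on_const) auto

lemma smooth_\<kappa>: "\<kappa> b \<in> smooth_functions A"
  using Ck_on_inner_const[OF _ Ck_on_bounded_linear[OF _ bounded_linear_ident]]
  by (intro smooth_bump_ext) (auto simp: smooth_on_def)

text \<open>
  On the ball \<open>\<kappa> b / \<beta>\<close> is the coordinate \<open>x\<^sub>b\<close>, so the coefficient below is \<open>\<beta>\<^sup>2 * Z x\<^sub>b\<close>. With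
  it no cut-off function that is constant near a point is needed.
\<close>

lemma frame_expansion_apply:
  assumes Z: "Z \<in> vector_fields A" and f: "f \<in> smooth_functions A"
  shows "\<beta> q ^ 3 * Z f q
    = (\<Sum>b\<in>Basis. (\<beta> q * Z (\<kappa> b) q - \<kappa> b q * Z \<beta> q) * coord_field b f q)"
proof (cases "\<beta> q = 0")
  case True
  then have "coord_field b f q = 0" for b
    by (auto simp: coord_field_def bump_ext_def split: if_splits)
  then show ?thesis using True by simp
next
  case False
  let ?i = "inv_into U x"
  define c where "c = x q"
  define F where "F = f \<circ> ?i"
  have q: "q \<in> U" "\<beta> q = B c" "c \<in> ball a R"
    using False B_zero[of c] by (auto simp: bump_ext_def c_def split: if_splits)
  have "smooth_on (ball a R) F"
    using smooth_on_subset[OF smooth_functionsD[OF f chart] ball] by (simp add: F_def)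
  then obtain h where h: "\<And>b. smooth_on (ball a R) (h b)"
      "\<And>b. h b c = frechet_derivative F (at c) b"
      "\<And>z. z \<in> ball a R \<Longrightarrow> F z = F c + (\<Sum>b\<in>Basis. ((z - c) \<bullet> b) * h b z)"
    using hadamard[OF open_ball convex_ball q(3)] by blast
  \<comment> \<open>\<open>u b\<close> is the cut-off coordinate difference and
    \<open>\<eta> b\<close> the cut-off Hadamard factor. Their product carries two bumps, so the
    Hadamard expansion becomes an identity of global functions only after multiplication by
    \<open>\<beta> * \<beta>\<close>.\<close>
  define u where "u = (\<lambda>b. \<kappa> b + (\<lambda>_. - (c \<bullet> b)) * \<beta>)"
  define \<eta> where "\<eta> = (\<lambda>b. bump_ext (h b))"
  have u: "u b \<in> smooth_functions A" for b
    unfolding u_def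
    by (intro smooth_functions_add smooth_functions_mult smooth_functions_const atlas smooth_\<beta> smooth_\<kappa>)
  have \<eta>: "\<eta> b \<in> smooth_functions A" for b
    unfolding \<eta>_def by (rule smooth_bump_ext) (rule h)
  have \<beta>2: "\<beta> * \<beta> \<in> smooth_functions A"
    by (intro smooth_functions_mult atlas smooth_\<beta>)
  have fi: "f q' = F (x q')" if "q' \<in> U" for q'
    using that by (simp add: F_def chart_inv_into[OF atlas chart])
  have "(\<beta> * \<beta>) * f = (\<lambda>_. F c) * (\<beta> * \<beta>) + (\<Sum>b\<in>Basis. u b * \<eta> b)"
  proof
    fix q'
    show "((\<beta> * \<beta>) * f) q' = ((\<lambda>_. F c) * (\<beta> * \<beta>) + (\<Sum>b\<in>Basis. u b * \<eta> b)) q'"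
    proof (cases "q' \<in> U \<and> x q' \<in> ball a R")
      case True
      have "f q' = F c + (\<Sum>b\<in>Basis. ((x q' - c) \<bullet> b) * h b (x q'))"
        using True fi h(3) by simp
      then show ?thesis
        using True by (simp add: u_def \<eta>_def bump_ext_def sum_fun_apply sum_distrib_left
            algebra_simps inner_diff_left)
    next
      case False
      then show ?thesis
        using B_zero by (auto simp: u_def \<eta>_def bump_ext_def sum_fun_apply)
    qed
  qed
  then have "Z ((\<beta> * \<beta>) * f) = Z ((\<lambda>_. F c) * (\<beta> * \<beta>) + (\<Sum>b\<in>Basis. u b * \<eta> b))"
    by simp
  also have "\<dots> = (\<lambda>_. F c) * Z (\<beta> * \<beta>) + (\<Sum>b\<in>Basis. Z (u b * \<eta> b))"
    using smooth_functions_mult[OF atlas u \<eta>] smooth_functions_mult[OF atlas smooth_functions_const[OF atlas] \<beta>2]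
    by (subst vector_fieldsD(3)[OF Z])
       (auto simp: vector_fieldsD(4)[OF Z \<beta>2] vector_field_sum[OF atlas Z] intro: smooth_functions_sum[OF atlas])
  \<comment> \<open>At \<open>q\<close> the terms with \<open>Z (\<beta> * \<beta>)\<close> cancel
    because \<open>f q = F c\<close>, and the unknown \<open>Z (\<eta> b)\<close> drop out because
    \<open>u b\<close> vanishes there.\<close>
  finally have "(Z (\<beta> * \<beta>) * f + (\<beta> * \<beta>) * Z f) q
      = ((\<lambda>_. F c) * Z (\<beta> * \<beta>) + (\<Sum>b\<in>Basis. Z (u b) * \<eta> b + u b * Z (\<eta> b))) q"
    by (simp only: vector_fieldsD(5)[OF Z \<beta>2 f] vector_fieldsD(5)[OF Z u \<eta>])
  moreover have "u b q = 0" for b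
    using q by (simp add: u_def bump_ext_def c_def)
  moreover have "Z (u b) q = Z (\<kappa> b) q - (c \<bullet> b) * Z \<beta> q" for b
    unfolding u_def
    by (simp add: vector_fieldsD(3)[OF Z] vector_fieldsD(4)[OF Z] smooth_\<beta> smooth_\<kappa>
        smooth_functions_mult[OF atlas smooth_functions_const[OF atlas]])
  ultimately have *: "\<beta> q * \<beta> q * Z f q = (\<Sum>b\<in>Basis. (Z (\<kappa> b) q - (c \<bullet> b) * Z \<beta> q) * \<eta> b q)"
    using fi[OF q(1)] by (simp add: sum_fun_apply c_def)
  \<comment> \<open>The Hadamard factor at \<open>c\<close> is the partial derivative, so
    \<open>\<eta> b q\<close> is the coordinate field applied to \<open>f\<close>. A third factor
    \<open>\<beta> q\<close> turns the constant \<open>c \<bullet> b\<close> into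
    \<open>\<kappa> b q\<close>, which makes the coefficient a smooth function not depending on
    \<open>q\<close>; hence the cube.\<close>
  have "\<eta> b q = coord_field b f q" for b
    using q(1) f h(2) by (simp add: \<eta>_def bump_ext_def coord_field_def c_def F_def)
  moreover have "\<kappa> b q = \<beta> q * (c \<bullet> b)" for b
    using q by (simp add: bump_ext_def c_def)
  moreover have "\<beta> q ^ 3 * Z f q = \<beta> q * (\<beta> q * \<beta> q * Z f q)"
    by (simp add: power3_eq_cube)
  ultimately show ?thesis
    unfolding * by (simp add: sum_distrib_left algebra_simps)
qed

lemma frame_expansion:
  assumes "Z \<in> vector_fields A"
  shows "fmult (\<beta> ^ 3) Z = (\<Sum>b\<in>Basis. fmult (\<beta> * Z (\<kappa> b) - \<kappa> b * Z \<beta>) (coord_field b))"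
proof (intro ext)
  fix f q
  have pow: "(\<beta> ^ 3) q = \<beta> q ^ 3"
    by (simp add: power3_eq_cube)
  show "fmult (\<beta> ^ 3) Z f q
      = (\<Sum>b\<in>Basis. fmult (\<beta> * Z (\<kappa> b) - \<kappa> b * Z \<beta>) (coord_field b)) f q"
  proof (cases "f \<in> smooth_functions A")
    case True
    then show ?thesis
      using frame_expansion_apply[OF assms True] by (simp add: fmult_def sum_fun_apply pow)
  next
    case False
    then show ?thesis
      using vector_fieldsD(2)[OF assms False]
      by (simp add: fmult_def sum_fun_apply coord_field_def)
  qed
qed

text \<open>The coordinate along \<open>d\<close> is not a global function, but
  \<open>\<kappa> d\<close> minus \<open>x p \<bullet> d\<close> times \<open>\<beta>\<close> can
  replace it at \<open>p\<close>: in this combination the derivatives of the bump cancel, and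
  \<open>coord_field b\<close> takes it to \<open>B (x p)\<close> squared times
  \<open>b \<bullet> d\<close>.\<close>

lemma frame_independent:
  assumes "\<beta> p \<noteq> 0" "zero_at p (\<Sum>b\<in>Basis. fmult (\<lambda>_. k b) (coord_field b))" "d \<in> Basis"
  shows "k d = 0"
proof -
  let ?i = "inv_into U x"
  let ?B' = "frechet_derivative B (at (x p))"
  have p: "p \<in> U" "\<beta> p = B (x p)"
    using assms(1) by (auto simp: bump_ext_def split: if_splits)
  have B': "(B has_derivative ?B') (at (x p))"
    by (rule Ck_on_Suc_has_derivative[OF Ck_on_bump]) simp
  have "((\<beta> \<circ> ?i) has_derivative ?B') (at (x p))"
    by (rule has_derivative_transform_within_open[OF B' chart_open(2)[OF atlas chart]])
       (use p(1) in \<open>auto simp: bump_ext_def chart_inv_into[OF atlas chart]\<close>)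
  then have E\<beta>: "coord_field b \<beta> p = B (x p) * ?B' b" for b
    using coord_field_apply[OF smooth_\<beta>] p by simp
  have "((\<lambda>z. B z * (z \<bullet> d)) has_derivative (\<lambda>v. B (x p) * (v \<bullet> d) + ?B' v * (x p \<bullet> d))) (at (x p))"
    by (intro has_derivative_mult B' has_derivative_inner_left has_derivative_ident)
  then have "((\<kappa> d \<circ> ?i) has_derivative (\<lambda>v. B (x p) * (v \<bullet> d) + ?B' v * (x p \<bullet> d))) (at (x p))"
    by (rule has_derivative_transform_within_open[OF _ chart_open(2)[OF atlas chart]])
       (use p(1) in \<open>auto simp: bump_ext_def chart_inv_into[OF atlas chart]\<close>)
  then have E\<kappa>: "coord_field b (\<kappa> d) p = B (x p) * (B (x p) * (b \<bullet> d) + ?B' b * (x p \<bullet> d))" for b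
    using coord_field_apply[OF smooth_\<kappa>] p by simp
  have "(\<Sum>b\<in>Basis. k b * coord_field b (\<kappa> d) p) = 0" "(\<Sum>b\<in>Basis. k b * coord_field b \<beta> p) = 0"
    using assms(2) by (auto simp: zero_at_def fmult_def sum_fun_apply)
  then have "0 = (\<Sum>b\<in>Basis. k b * coord_field b (\<kappa> d) p) - (x p \<bullet> d) * (\<Sum>b\<in>Basis. k b * coord_field b \<beta> p)"
    by simp
  also have "\<dots> = (\<Sum>b\<in>Basis. k b * (B (x p) * B (x p) * (b \<bullet> d)))"
    by (simp add: E\<beta> E\<kappa> sum_distrib_left sum_subtractf[symmetric] algebra_simps)
  also have "\<dots> = (\<Sum>b\<in>Basis. if b = d then k d * (B (x p) * B (x p)) else 0)"
    using assms(3) by (intro sum.cong) (auto simp: inner_Basis)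
  also have "\<dots> = k d * (B (x p) * B (x p))"
    using assms(3) by simp
  finally show ?thesis using assms(1) p by auto
qed

end

text \<open>\<open>\<beta>\<close> cuts off: the \<open>E i\<close> span the tangent spaces at the points where \<open>\<beta>\<close> does not vanish.\<close>

definition frame_at ::
  "('m::topological_space, 'e::euclidean_space) chart set \<Rightarrow> 'm \<Rightarrow> nat \<Rightarrow> (nat \<Rightarrow> 'm vfield) \<Rightarrow> 'm sfun \<Rightarrow> bool" where
  "frame_at A p n E \<beta> \<longleftrightarrow>
     \<beta> \<in> smooth_functions A \<and> \<beta> p \<noteq> 0 \<and> (\<forall>i. E i \<in> vector_fields A) \<and>
     (\<forall>Z\<in>vector_fields A. \<exists>k. (\<forall>i. k i \<in> smooth_functions A) \<and>
       (\<forall>i q. zero_at q Z \<longrightarrow> k i q = 0) \<and> fmult \<beta> Z = (\<Sum>i<n. fmult (k i) (E i))) \<and>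
     (\<forall>c. zero_at p (\<Sum>i<n. fmult (\<lambda>_. c i) (E i)) \<longrightarrow> (\<forall>i<n. c i = 0))"

lemma frame_atD:
  assumes "frame_at A p n E \<beta>"
  shows "\<beta> \<in> smooth_functions A" "\<beta> p \<noteq> 0" "E i \<in> vector_fields A"
    and "Z \<in> vector_fields A \<Longrightarrow> \<exists>k. (\<forall>i. k i \<in> smooth_functions A) \<and>
       (\<forall>i q. zero_at q Z \<longrightarrow> k i q = 0) \<and> fmult \<beta> Z = (\<Sum>i<n. fmult (k i) (E i))"
    and "zero_at p (\<Sum>i<n. fmult (\<lambda>_. c i) (E i)) \<Longrightarrow> i < n \<Longrightarrow> c i = 0"
  using assms unfolding frame_at_def by blast+

lemma frame_at_exists:
  fixes A :: "('m::t2_space, 'e::euclidean_space) chart set"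
  assumes "smooth_atlas A"
  obtains n E \<beta> where "frame_at A p n E \<beta>"
proof -
  have "p \<in> (\<Union>c\<in>A. fst c)"
    using assms by (simp add: smooth_atlas_def)
  then obtain U x where c: "(U, x) \<in> A" "p \<in> U"
    by auto
  obtain R where R: "R > 0" "ball (x p) R \<subseteq> x ` U"
    using chart_open(2)[OF assms c(1)] c(2) by (meson image_eqI openE)
  interpret chart_ball A U x "x p" "R / 2" R
    using assms c R by unfold_locales auto
  \<comment> \<open>The basis is numbered since the Gram matrix below is indexed by natural
    numbers.\<close>
  obtain e where "bij_betw e {0..<DIM('e)} (Basis :: 'e set)"
    using ex_bij_betw_nat_finite[OF finite_Basis] by blast
  then have e: "bij_betw e {..<DIM('e)} (Basis :: 'e set)"
    by (simp add: atLeast0LessThan)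
  have reindex: "(\<Sum>b\<in>Basis. F b) = (\<Sum>i<DIM('e). F (e i))" for F :: "'e \<Rightarrow> 'm vfield"
    by (rule sum.reindex_bij_betw[OF e, symmetric])
  show thesis
  proof (rule that[of "DIM('e)" "\<lambda>i. coord_field (e i)" "\<beta> ^ 3"], unfold frame_at_def,
      intro conjI ballI allI impI)
    have p: "\<beta> p \<noteq> 0"
      using c(2) bump_nonzero[of "R / 2" "x p" "x p"] R by (simp add: bump_ext_def)
    show "\<beta> ^ 3 \<in> smooth_functions A"
      by (simp add: power3_eq_cube smooth_functions_mult assms smooth_\<beta>)
    show "(\<beta> ^ 3) p \<noteq> 0"
      using p by (simp add: power3_eq_cube)
    show "coord_field (e i) \<in> vector_fields A" for i
      by (rule coord_field_in_vector_fields)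
    show "\<exists>k. (\<forall>i. k i \<in> smooth_functions A) \<and> (\<forall>i q. zero_at q Z \<longrightarrow> k i q = 0) \<and>
        fmult (\<beta> ^ 3) Z = (\<Sum>i<DIM('e). fmult (k i) (coord_field (e i)))"
      if Z: "Z \<in> vector_fields A" for Z
    \<comment> \<open>These coefficients are built from values of \<open>Z\<close> at the same
      point, so they vanish wherever \<open>Z\<close> does. This clause of \<open>frame_at\<close>
      is what makes 1-forms act pointwise.\<close>
    proof (intro exI[of _ "\<lambda>i. \<beta> * Z (\<kappa> (e i)) - \<kappa> (e i) * Z \<beta>"] conjI allI impI)
      show "\<beta> * Z (\<kappa> (e i)) - \<kappa> (e i) * Z \<beta> \<in> smooth_functions A" for i
        unfolding diff_conv_add_uminus
        by (intro smooth_functions_add smooth_functions_mult smooth_functions_uminus assms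
            vector_fieldsD(1)[OF Z] smooth_\<beta> smooth_\<kappa>)
      show "fmult (\<beta> ^ 3) Z = (\<Sum>i<DIM('e). fmult (\<beta> * Z (\<kappa> (e i)) - \<kappa> (e i) * Z \<beta>) (coord_field (e i)))"
        using frame_expansion[OF Z] reindex by simp
    qed (simp add: zero_at_def)
    fix k :: "nat \<Rightarrow> real" and i
    assume z: "zero_at p (\<Sum>i<DIM('e). fmult (\<lambda>_. k i) (coord_field (e i)))" and i: "i < DIM('e)"
    let ?e' = "inv_into {..<DIM('e)} e"
    have "?e' (e j) = j" if "j < DIM('e)" for j
      using e that by (auto simp: bij_betw_def)
    then have "zero_at p (\<Sum>b\<in>Basis. fmult (\<lambda>_. k (?e' b)) (coord_field b))"
      using z by (simp add: reindex)
    from frame_independent[OF p this, of "e i"] show "k i = 0"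
      using e i by (auto simp: bij_betw_def)
  qed
qed

section \<open>Determinants and adjugates of matrices of smooth functions\<close>

lemma smooth_functions_one: "smooth_atlas A \<Longrightarrow> 1 \<in> smooth_functions A"
  using smooth_functions_const[of A 1] by (simp add: func_one)

lemma smooth_functions_prod:
  "smooth_atlas A \<Longrightarrow> (\<And>i. i \<in> I \<Longrightarrow> f i \<in> smooth_functions A) \<Longrightarrow> prod f I \<in> smooth_functions A"
  by (induction I rule: infinite_finite_induct)
     (auto intro: smooth_functions_one smooth_functions_mult)

text \<open>The determinant is taken over the type of all real functions with pointwise operations,
  which is a commutative ring; the Leibniz formula shows that it stays in the smooth ones.\<close>

lemma smooth_functions_det:
  assumes "smooth_atlas A" "M \<in> carrier_mat n n"
    and "\<And>i j. i < n \<Longrightarrow> j < n \<Longrightarrow> M $$ (i, j) \<in> smooth_functions A"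
  shows "det M \<in> smooth_functions A"
proof -
  have sgn: "signof p \<in> smooth_functions A" for p :: "nat \<Rightarrow> nat"
    using smooth_functions_one[OF assms(1)] smooth_functions_uminus[OF assms(1)]
    by (auto simp: sign_def)
  have "M $$ (i, p i) \<in> smooth_functions A" if "p permutes {0..<n}" "i \<in> {0..<n}" for p i
    using permutes_in_image[OF that(1)] that(2) by (intro assms(3)) auto
  then show ?thesis
    unfolding det_def'[OF assms(2)]
    by (intro smooth_functions_sum smooth_functions_mult smooth_functions_prod sgn assms(1)) auto
qed

lemma smooth_functions_adj_mat:
  assumes "smooth_atlas A" "M \<in> carrier_mat n n"
    and "\<And>i j. i < n \<Longrightarrow> j < n \<Longrightarrow> M $$ (i, j) \<in> smooth_functions A"
    and "i < n" "j < n"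
  shows "adj_mat M $$ (i, j) \<in> smooth_functions A"
proof -
  have "det (mat_delete M j i) \<in> smooth_functions A"
    using assms(2-5) by (intro smooth_functions_det[OF assms(1) mat_delete_carrier[OF assms(2)]])
      (auto simp: mat_delete_def)
  moreover have "(- 1) ^ (j + i) \<in> smooth_functions A"
    using smooth_functions_one[OF assms(1)] smooth_functions_uminus[OF assms(1)]
    by (auto simp: uminus_power_if)
  ultimately show ?thesis
    using assms(2,4,5) by (auto simp: adj_mat_def cofactor_def intro: smooth_functions_mult[OF assms(1)])
qed

subsection \<open>One-forms\<close>

lemma one_formsD:
  assumes "\<xi> \<in> one_forms A"
  shows "X \<in> vector_fields A \<Longrightarrow> \<xi> X \<in> smooth_functions A"
    and "X \<notin> vector_fields A \<Longrightarrow> \<xi> X = 0"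
    and "X \<in> vector_fields A \<Longrightarrow> Y \<in> vector_fields A \<Longrightarrow> \<xi> (X + Y) = \<xi> X + \<xi> Y"
    and "f \<in> smooth_functions A \<Longrightarrow> X \<in> vector_fields A \<Longrightarrow> \<xi> (fmult f X) = f * \<xi> X"
  using assms by (auto simp: one_forms_def)

lemma one_form_zero:
  assumes "smooth_atlas A" "\<xi> \<in> one_forms A"
  shows "\<xi> 0 = 0"
  using one_formsD(3)[OF assms(2) vector_fields_zero vector_fields_zero, OF assms(1,1)] by simp

lemma one_form_sum:
  assumes "smooth_atlas A" "\<xi> \<in> one_forms A"
    and "\<And>i. i \<in> I \<Longrightarrow> k i \<in> smooth_functions A" "\<And>i. i \<in> I \<Longrightarrow> E i \<in> vector_fields A"
  shows "\<xi> (\<Sum>i\<in>I. fmult (k i) (E i)) = (\<Sum>i\<in>I. k i * \<xi> (E i))"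
  using assms(3,4)
proof (induction I rule: infinite_finite_induct)
  case (insert i I)
  have "\<xi> (fmult (k i) (E i) + (\<Sum>i\<in>I. fmult (k i) (E i)))
      = \<xi> (fmult (k i) (E i)) + \<xi> (\<Sum>i\<in>I. fmult (k i) (E i))"
    using insert.prems
    by (intro one_formsD(3)[OF assms(2)] vector_fields_sum[OF assms(1)] vector_fields_fmult[OF assms(1)]) auto
  moreover have "\<xi> (fmult (k i) (E i)) = k i * \<xi> (E i)"
    using insert.prems by (intro one_formsD(4)[OF assms(2)]) auto
  moreover have "\<xi> (\<Sum>i\<in>I. fmult (k i) (E i)) = (\<Sum>i\<in>I. k i * \<xi> (E i))"
    by (rule insert.IH) (use insert.prems in auto)
  ultimately show ?case
    by (simp only: sum.insert[OF insert.hyps(1,2)])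
qed (simp_all add: one_form_zero[OF assms(1,2)])

text \<open>Apply \<open>\<xi>\<close> to the expansion of \<open>fmult \<beta> Z\<close> in a
  frame: at \<open>p\<close> all coefficients vanish while \<open>\<beta>\<close> does not.\<close>

lemma one_form_zero_at:
  fixes A :: "('m::t2_space, 'e::euclidean_space) chart set"
  assumes "smooth_atlas A" "\<xi> \<in> one_forms A" "Z \<in> vector_fields A" "zero_at p Z"
  shows "\<xi> Z p = 0"
proof -
  obtain n E \<beta> where "frame_at A p n E \<beta>"
    using frame_at_exists[OF assms(1)] by blast
  note fr = frame_atD[OF this]
  obtain k where k: "\<And>i. k i \<in> smooth_functions A" "\<And>i. k i p = 0"
    "fmult \<beta> Z = (\<Sum>i<n. fmult (k i) (E i))"
    using fr(4)[OF assms(3)] assms(4) by blast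
  have "\<beta> * \<xi> Z = (\<Sum>i<n. k i * \<xi> (E i))"
    unfolding one_formsD(4)[OF assms(2) fr(1) assms(3), symmetric] k(3)
    by (rule one_form_sum[OF assms(1,2) k(1) fr(3)])
  then have "(\<beta> * \<xi> Z) p = (\<Sum>i<n. k i * \<xi> (E i)) p"
    by (rule fun_cong)
  then show ?thesis
    using fr(2) k(2) by (simp add: sum_fun_apply)
qed

lemma one_forms_add:
  "smooth_atlas A \<Longrightarrow> \<xi> \<in> one_forms A \<Longrightarrow> \<eta> \<in> one_forms A \<Longrightarrow> \<xi> + \<eta> \<in> one_forms A"
  unfolding one_forms_def by (auto simp: smooth_functions_add algebra_simps)

lemma one_forms_fmult:
  "smooth_atlas A \<Longrightarrow> f \<in> smooth_functions A \<Longrightarrow> \<xi> \<in> one_forms A \<Longrightarrow> fmult f \<xi> \<in> one_forms A"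
  unfolding one_forms_def fmult_def[of f \<xi>] by (auto simp: smooth_functions_mult algebra_simps)

lemma dual_map_in_one_forms:
  assumes "smooth_atlas A" "module_endo (smooth_functions A) (vector_fields A) fmult J" "\<xi> \<in> one_forms A"
  shows "dual_map A J \<xi> \<in> one_forms A"
  using assms(2) one_formsD[OF assms(3)] vector_fields_add[OF assms(1)] vector_fields_fmult[OF assms(1)]
  unfolding one_forms_def dual_map_def module_endo_def by auto

lemma gsectionsE:
  assumes "u \<in> gsections A"
  obtains X \<xi> where "u = (X, \<xi>)" "X \<in> vector_fields A" "\<xi> \<in> one_forms A"
  using assms unfolding gsections_def by (rule SigmaE)

subsection \<open>Musical isomorphisms\<close>

locale metric_on_manifold =
  fixes A :: "('m::t2_space, 'e::euclidean_space) chart set"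
    and g :: "'m vfield \<Rightarrow> 'm vfield \<Rightarrow> 'm sfun"
  assumes atlas: "smooth_atlas A"
    and is_metric: "is_metric (smooth_functions A) (vector_fields A) fmult zero_at g"
begin

lemma metricD:
  assumes "X \<in> vector_fields A" "Y \<in> vector_fields A"
  shows "g X Y \<in> smooth_functions A" "g X Y = g Y X"
    and "W \<in> vector_fields A \<Longrightarrow> g (X + Y) W = g X W + g Y W"
    and "W \<in> vector_fields A \<Longrightarrow> g W (X + Y) = g W X + g W Y"
    and "f \<in> smooth_functions A \<Longrightarrow> g (fmult f X) Y = f * g X Y"
    and "f \<in> smooth_functions A \<Longrightarrow> g X (fmult f Y) = f * g X Y"
  using is_metric assms by (auto simp: is_metric_def bilinear_form_def)

lemma nondegenerateD:
  "X \<in> vector_fields A \<Longrightarrow> (\<And>Y. Y \<in> vector_fields A \<Longrightarrow> g X Y p = 0) \<Longrightarrow> zero_at p X"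
  using is_metric by (auto simp: is_metric_def nondegenerate_def)

lemma flat_apply: "Y \<in> vector_fields A \<Longrightarrow> flat A g X Y = g X Y"
  by (simp add: flat_def)

lemma flat_in_one_forms: "X \<in> vector_fields A \<Longrightarrow> flat A g X \<in> one_forms A"
  unfolding one_forms_def flat_def
  by (auto simp: metricD vector_fields_add[OF atlas] vector_fields_fmult[OF atlas])

lemma metric_zero_at:
  assumes "X \<in> vector_fields A" "Y \<in> vector_fields A" "zero_at p X"
  shows "g X Y p = 0"
  using one_form_zero_at[OF atlas flat_in_one_forms[OF assms(2)] assms(1,3)] assms(1,2)
  by (simp add: flat_apply metricD(2))

text \<open>Cramer's rule for the Gram matrix of a local frame, over the ring of smooth functions.\<close>

lemma local_sharp:
  assumes \<xi>: "\<xi> \<in> one_forms A"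
  obtains W D where "W \<in> vector_fields A" "D \<in> smooth_functions A" "D p \<noteq> 0"
    "\<And>Y. Y \<in> vector_fields A \<Longrightarrow> g W Y = D * \<xi> Y"
proof -
  obtain n E \<beta> where "frame_at A p n E \<beta>"
    using frame_at_exists[OF atlas] by blast
  note fr = frame_atD[OF this]
  define G where "G = mat n n (\<lambda>(i, j). g (E i) (E j))"
  have G: "G \<in> carrier_mat n n"
    by (simp add: G_def)
  have Gs: "G $$ (i, j) \<in> smooth_functions A" if "i < n" "j < n" for i j
    using that by (simp add: G_def metricD(1) fr(3))
  \<comment> \<open>The row of values of \<open>\<xi>\<close> times the adjugate: multiplied by
    \<open>G\<close> it returns \<open>det G\<close> times that row, without any division.\<close>
  define c where "c = (\<lambda>j. \<Sum>i<n. \<xi> (E i) * adj_mat G $$ (i, j))"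
  define W where "W = (\<Sum>j<n. fmult (c j) (E j))"
  have cs: "c j \<in> smooth_functions A" if "j \<in> {..<n}" for j
    unfolding c_def using that
    by (intro smooth_functions_sum[OF atlas] smooth_functions_mult[OF atlas] one_formsD(1)[OF \<xi>] fr(3)
        smooth_functions_adj_mat[OF atlas G Gs]) auto
  have W: "W \<in> vector_fields A"
    unfolding W_def by (intro vector_fields_sum[OF atlas] vector_fields_fmult[OF atlas] cs fr(3))
  have dets: "det G \<in> smooth_functions A"
    by (rule smooth_functions_det[OF atlas G Gs])
  have adj: "(\<Sum>j<n. adj_mat G $$ (i, j) * G $$ (j, k)) = (if i = k then det G else 0)"
    if "i < n" "k < n" for i k
  proof -
    have "(adj_mat G * G) $$ (i, k) = (\<Sum>j<n. adj_mat G $$ (i, j) * G $$ (j, k))"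
      using that G adj_mat(1)[OF G] by (simp add: scalar_prod_def atLeast0LessThan)
    then show ?thesis
      using that by (cases "i = k") (simp_all add: adj_mat(3)[OF G])
  qed
  have gW: "g W (E k) = det G * \<xi> (E k)" if k: "k < n" for k
  proof -
    have "g W (E k) = flat A g (E k) W"
      using W fr(3) by (simp add: flat_apply metricD(2))
    also have "\<dots> = (\<Sum>j<n. c j * flat A g (E k) (E j))"
      unfolding W_def by (intro one_form_sum[OF atlas flat_in_one_forms] cs fr(3))
    also have "\<dots> = (\<Sum>j<n. \<Sum>i<n. \<xi> (E i) * (adj_mat G $$ (i, j) * G $$ (j, k)))"
    proof (rule sum.cong[OF refl])
      fix j assume "j \<in> {..<n}"
      then have "flat A g (E k) (E j) = G $$ (j, k)"
        using k fr(3) by (simp add: flat_apply G_def metricD(2))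
      then show "c j * flat A g (E k) (E j)
          = (\<Sum>i<n. \<xi> (E i) * (adj_mat G $$ (i, j) * G $$ (j, k)))"
        by (simp add: c_def sum_distrib_right mult.assoc)
    qed
    also have "\<dots> = (\<Sum>i<n. \<xi> (E i) * (\<Sum>j<n. adj_mat G $$ (i, j) * G $$ (j, k)))"
      unfolding sum_distrib_left by (rule sum.swap)
    also have "\<dots> = (\<Sum>i<n. if i = k then \<xi> (E k) * det G else 0)"
      using k by (intro sum.cong) (simp_all add: adj)
    also have "\<dots> = det G * \<xi> (E k)"
      using k by (simp add: mult.commute)
    finally show ?thesis .
  qed
  have expand: "\<beta> * g V Y = (\<Sum>i<n. k i * g V (E i))"
    if V: "V \<in> vector_fields A" and Y: "Y \<in> vector_fields A"
      and k: "\<And>i. k i \<in> smooth_functions A" "fmult \<beta> Y = (\<Sum>i<n. fmult (k i) (E i))" for V Y k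
  proof -
    have "\<beta> * g V Y = flat A g V (fmult \<beta> Y)"
      using V Y fr(1) by (simp add: flat_apply metricD(6) vector_fields_fmult[OF atlas])
    also have "\<dots> = (\<Sum>i<n. k i * flat A g V (E i))"
      unfolding k(2) by (intro one_form_sum[OF atlas flat_in_one_forms] V k(1) fr(3))
    finally show ?thesis using fr(3) by (simp add: flat_apply)
  qed
  have "det G p \<noteq> 0"
  proof
    assume "det G p = 0"
    \<comment> \<open>Evaluation at \<open>p\<close> is a ring homomorphism and hence commutes with
      \<open>det\<close>, so linear algebra over the reals supplies a kernel vector of the Gram
      matrix at \<open>p\<close>.\<close>
    interpret ev: comm_ring_hom "\<lambda>f :: 'm \<Rightarrow> real. f p"
      by unfold_locales auto
    let ?G = "map_mat (\<lambda>f. f p) G"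
    have "det ?G = 0"
      using \<open>det G p = 0\<close> by simp
    then obtain v where v: "v \<in> carrier_vec n" "v \<noteq> 0\<^sub>v n" "?G *\<^sub>v v = 0\<^sub>v n"
      using det_0_iff_vec_prod_zero[of ?G n] G by auto
    \<comment> \<open>The kernel vector read as a field: it is orthogonal at \<open>p\<close> to the
      frame, hence to every field, so it vanishes at \<open>p\<close> and independence of the frame
      makes the kernel vector zero.\<close>
    define V where "V = (\<Sum>i<n. fmult (\<lambda>_. v $ i) (E i))"
    have V: "V \<in> vector_fields A"
      unfolding V_def
      by (intro vector_fields_sum[OF atlas] vector_fields_fmult[OF atlas] smooth_functions_const[OF atlas] fr(3))
    have gV: "g V (E i) p = 0" if i: "i < n" for i
    proof -
      have "g V (E i) = flat A g (E i) V"
        using V fr(3) by (simp add: flat_apply metricD(2))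
      also have "\<dots> = (\<Sum>j<n. (\<lambda>_. v $ j) * flat A g (E i) (E j))"
        unfolding V_def by (intro one_form_sum[OF atlas flat_in_one_forms] smooth_functions_const[OF atlas] fr(3))
      finally have "g V (E i) p = (\<Sum>j<n. v $ j * g (E i) (E j) p)"
        using fr(3) by (simp add: flat_apply sum_fun_apply)
      also have "\<dots> = (?G *\<^sub>v v) $ i"
        using i v(1) G by (simp add: scalar_prod_def G_def atLeast0LessThan mult.commute)
      finally show ?thesis using i by (simp add: v(3))
    qed
    have "zero_at p V"
    proof (rule nondegenerateD[OF V])
      fix Y assume Y: "Y \<in> vector_fields A"
      obtain k where "\<And>i. k i \<in> smooth_functions A" "fmult \<beta> Y = (\<Sum>i<n. fmult (k i) (E i))"
        using fr(4)[OF Y] by blast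
      from expand[OF V Y this] have "(\<beta> * g V Y) p = (\<Sum>i<n. k i * g V (E i)) p"
        by (rule fun_cong)
      then show "g V Y p = 0"
        using fr(2) by (simp add: sum_fun_apply gV)
    qed
    then have "v $ i = 0" if "i < n" for i
      using fr(5)[of "\<lambda>i. v $ i"] that by (simp add: V_def)
    then show False
      using v(1,2) by (auto simp: vec_eq_iff)
  qed
  \<comment> \<open>\<open>W\<close> is controlled only on the frame, and an arbitrary
    \<open>Y\<close> expands in the frame only after multiplication by \<open>\<beta>\<close>; so
    both sides receive this factor.\<close>
  show thesis
  proof (rule that[of "fmult \<beta> W" "\<beta> * det G"])
    show "fmult \<beta> W \<in> vector_fields A" "\<beta> * det G \<in> smooth_functions A"
      by (intro vector_fields_fmult[OF atlas] smooth_functions_mult[OF atlas] W fr(1) dets)+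
    show "(\<beta> * det G) p \<noteq> 0"
      using fr(2) \<open>det G p \<noteq> 0\<close> by simp
    fix Y assume Y: "Y \<in> vector_fields A"
    obtain k where k: "\<And>i. k i \<in> smooth_functions A" "fmult \<beta> Y = (\<Sum>i<n. fmult (k i) (E i))"
      using fr(4)[OF Y] by blast
    have "g (fmult \<beta> W) Y = (\<Sum>i<n. k i * g W (E i))"
      using expand[OF W Y k] W Y fr(1) by (simp only: metricD(5))
    also have "\<dots> = (\<Sum>i<n. det G * (k i * \<xi> (E i)))"
      by (intro sum.cong) (simp_all add: gW mult.left_commute)
    also have "\<dots> = det G * \<xi> (fmult \<beta> Y)"
      unfolding k(2) one_form_sum[OF atlas \<xi> k(1) fr(3)] by (simp only: sum_distrib_left)
    also have "\<dots> = \<beta> * det G * \<xi> Y"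
      by (simp only: one_formsD(4)[OF \<xi> fr(1) Y] ac_simps)
    finally show "g (fmult \<beta> W) Y = \<beta> * det G * \<xi> Y" .
  qed
qed

lemma flat_surj:
  assumes \<xi>: "\<xi> \<in> one_forms A"
  shows "\<exists>Z\<in>vector_fields A. flat A g Z = \<xi>"
proof -
  have "\<forall>p. \<exists>W D. W \<in> vector_fields A \<and> D \<in> smooth_functions A \<and> D p \<noteq> 0 \<and>
      (\<forall>Y\<in>vector_fields A. g W Y = D * \<xi> Y)"
    using local_sharp[OF \<xi>] by metis
  then obtain W D where WD: "\<And>p. W p \<in> vector_fields A" "\<And>p. D p \<in> smooth_functions A" "\<And>p. D p p \<noteq> 0"
    "\<And>p Y. Y \<in> vector_fields A \<Longrightarrow> g (W p) Y = D p * \<xi> Y"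
    by metis
  \<comment> \<open>A diagonal choice: the value at \<open>p\<close> is taken from the solution that
    belongs to \<open>p\<close> itself. That this varies smoothly is the content of
    \<open>local\<close>.\<close>
  define Z where "Z = (\<lambda>f p. W p f p / D p p)"
  have local: "Z f q = W p f q / D p q" if "D p q \<noteq> 0" for f p q
  proof -
    \<comment> \<open>The denominators are frozen at \<open>q\<close>. Paired with \<open>Y\<close>
      at \<open>q\<close>, both summands give the product of the denominators times
      \<open>\<xi> Y q\<close>, with opposite signs.\<close>
    let ?T = "fmult (\<lambda>_. D q q) (W p) + fmult (\<lambda>_. - D p q) (W q)"
    have "zero_at q ?T"
    proof (rule nondegenerateD)
      show "?T \<in> vector_fields A"
        by (intro vector_fields_add vector_fields_fmult smooth_functions_const atlas WD)
      fix Y assume "Y \<in> vector_fields A"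
      then show "g ?T Y q = 0"
        by (simp add: metricD(3,5) WD vector_fields_fmult[OF atlas] smooth_functions_const[OF atlas])
    qed
    then have "D q q * W p f q = D p q * W q f q"
      by (simp add: zero_at_def fmult_def)
    then show ?thesis
      using that WD(3)[of q] by (simp add: Z_def field_simps)
  qed
  have Z: "Z \<in> vector_fields A"
    unfolding vector_fields_def mem_Collect_eq
  proof (intro conjI ballI allI impI)
    show "Z f \<in> smooth_functions A" if "f \<in> smooth_functions A" for f
    proof (rule smooth_functions_local_quotient[OF atlas])
      fix p
      show "\<exists>u\<in>smooth_functions A. \<exists>D\<in>smooth_functions A.
          D p \<noteq> 0 \<and> (\<forall>q. D q \<noteq> 0 \<longrightarrow> Z f q = u q / D q)"
        by (intro bexI[of _ "W p f"] bexI[of _ "D p"] conjI allI impI local WD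
            vector_fieldsD(1)[OF WD(1) that])
    qed
    fix f assume "f \<in> smooth_functions A"
    then show "Z ((\<lambda>_. c) * f) = (\<lambda>_. c) * Z f" for c
      by (simp add: Z_def fun_eq_iff vector_fieldsD(4)[OF WD(1)])
  next
    fix f assume "f \<notin> smooth_functions A"
    then show "Z f = 0"
      by (simp add: Z_def fun_eq_iff vector_fieldsD(2)[OF WD(1)])
  next
    fix f h assume fh: "f \<in> smooth_functions A" "h \<in> smooth_functions A"
    show "Z (f + h) = Z f + Z h"
      by (simp add: Z_def fun_eq_iff vector_fieldsD(3)[OF WD(1) fh] add_divide_distrib)
    show "Z (f * h) = Z f * h + f * Z h"
      by (simp add: Z_def fun_eq_iff vector_fieldsD(5)[OF WD(1) fh] add_divide_distrib)
  qed
  have "g Z Y q = \<xi> Y q" if Y: "Y \<in> vector_fields A" for Y q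
  proof -
    \<comment> \<open>At \<open>q\<close> the field \<open>Z\<close> is \<open>W q\<close> divided
      by a real number, so this difference vanishes there; pointwise dependence of \<open>g\<close>
      then transfers the equation for \<open>W q\<close> to \<open>Z\<close>.\<close>
    let ?T = "fmult (\<lambda>_. D q q) Z + fmult (\<lambda>_. - 1) (W q)"
    have "?T \<in> vector_fields A"
      by (intro vector_fields_add vector_fields_fmult smooth_functions_const atlas WD Z)
    moreover have "zero_at q ?T"
      using WD(3) by (simp add: zero_at_def fmult_def Z_def)
    ultimately have "g ?T Y q = 0"
      using Y by (intro metric_zero_at)
    then have "D q q * g Z Y q = D q q * \<xi> Y q"
      using Y by (simp add: metricD(3,5) WD Z vector_fields_fmult[OF atlas] smooth_functions_const[OF atlas])
    then show ?thesis using WD(3) by simp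
  qed
  then have "flat A g Z = \<xi>"
    using one_formsD(2)[OF \<xi>] by (auto simp: flat_def fun_eq_iff)
  then show ?thesis using Z by blast
qed

lemma flat_inj: "inj_on (flat A g) (vector_fields A)"
proof (rule inj_onI)
  fix X X' assume X: "X \<in> vector_fields A" "X' \<in> vector_fields A" and eq: "flat A g X = flat A g X'"
  have "zero_at p (X - X')" for p
  proof (rule nondegenerateD)
    show V: "X - X' \<in> vector_fields A"
      using vector_fields_diff[OF atlas] X by blast
    fix Y assume Y: "Y \<in> vector_fields A"
    have "g X Y = g ((X - X') + X') Y"
      by simp
    also have "\<dots> = g (X - X') Y + g X' Y"
      by (rule metricD(3)[OF V X(2) Y])
    finally show "g (X - X') Y p = 0"
      using fun_cong[OF eq, of Y] Y by (simp add: flat_apply)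
  qed
  then show "X = X'"
    by (simp add: zero_at_def fun_eq_iff)
qed

abbreviation sh :: "'m form \<Rightarrow> 'm vfield" where "sh \<equiv> sharp A g"

lemma sharp_in_vector_fields: "\<xi> \<in> one_forms A \<Longrightarrow> sh \<xi> \<in> vector_fields A"
  using flat_surj unfolding sharp_def by (metis image_eqI inv_into_into)

lemma metric_sharp: "\<xi> \<in> one_forms A \<Longrightarrow> Y \<in> vector_fields A \<Longrightarrow> g (sh \<xi>) Y = \<xi> Y"
  using flat_surj unfolding sharp_def by (metis f_inv_into_f flat_apply image_eqI)

text \<open>Injectivity of \<open>flat\<close> turns the defining property of the sharp into a
  characterization, through which concrete sharps are computed below.\<close>

lemma sharp_eqI:
  assumes "\<xi> \<in> one_forms A" "X \<in> vector_fields A" "\<And>Y. Y \<in> vector_fields A \<Longrightarrow> g X Y = \<xi> Y"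
  shows "sh \<xi> = X"
proof -
  have "flat A g X = \<xi>"
    using assms(3) one_formsD(2)[OF assms(1)] by (auto simp: flat_def fun_eq_iff)
  then show ?thesis
    using inv_into_f_f[OF flat_inj assms(2)] by (simp add: sharp_def)
qed

lemma sharp_flat: "X \<in> vector_fields A \<Longrightarrow> sh (flat A g X) = X"
  by (simp add: sharp_def inv_into_f_f[OF flat_inj])

lemma sharp_add:
  "\<xi> \<in> one_forms A \<Longrightarrow> \<eta> \<in> one_forms A \<Longrightarrow> sh (\<xi> + \<eta>) = sh \<xi> + sh \<eta>"
  by (rule sharp_eqI)
     (simp_all add: one_forms_add[OF atlas] vector_fields_add[OF atlas] sharp_in_vector_fields metricD(3) metric_sharp)

lemma sharp_fmult:
  "f \<in> smooth_functions A \<Longrightarrow> \<xi> \<in> one_forms A \<Longrightarrow> sh (fmult f \<xi>) = fmult f (sh \<xi>)"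
  by (rule sharp_eqI[OF one_forms_fmult[OF atlas]])
     (simp_all add: vector_fields_fmult[OF atlas] sharp_in_vector_fields metricD(5) metric_sharp
       fmult_def[of f \<xi>])

text \<open>\<open>gzero_at\<close> looks at the form itself, whereas the induced metric sees only
  its sharp.\<close>

lemma zero_at_sharp:
  assumes "\<xi> \<in> one_forms A"
  shows "zero_at p (sh \<xi>) \<longleftrightarrow> zero_at p \<xi>"
proof
  assume z: "zero_at p (sh \<xi>)"
  have "\<xi> Y p = 0" for Y
    using metric_zero_at[OF sharp_in_vector_fields[OF assms] _ z] metric_sharp[OF assms] one_formsD(2)[OF assms]
    by (cases "Y \<in> vector_fields A") auto
  then show "zero_at p \<xi>" by (simp add: zero_at_def)
next
  assume "zero_at p \<xi>"
  then show "zero_at p (sh \<xi>)"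
    by (intro nondegenerateD sharp_in_vector_fields assms) (simp add: metric_sharp assms zero_at_def)
qed

section \<open>The induced metric on the generalized tangent bundle\<close>

lemma one_forms_zero: "0 \<in> one_forms A"
  by (auto simp: one_forms_def smooth_functions_zero[OF atlas])

lemma metric_at_zero:
  assumes "X \<in> vector_fields A"
  shows "g X 0 p = 0" "g 0 X p = 0"
  using metric_zero_at[OF vector_fields_zero[OF atlas] assms, of p] metricD(2)[OF vector_fields_zero[OF atlas] assms]
  by (auto simp: zero_at_def)

lemma sharp_zero: "sh 0 = 0"
  using metric_at_zero(2)
  by (intro sharp_eqI[OF one_forms_zero vector_fields_zero[OF atlas]]) (simp add: fun_eq_iff)

lemma induced_generalized_metric: "generalized_metric A (induced_metric A g)"
  unfolding generalized_metric_def is_metric_def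
proof (intro conjI ballI)
  let ?G = "induced_metric A g"
  note mem = sharp_in_vector_fields vector_fields_add[OF atlas] vector_fields_fmult[OF atlas]
  have val: "?G (X, \<xi>) (Y, \<eta>) = g X Y + g (sh \<xi>) (sh \<eta>)" for X Y \<xi> \<eta>
    by (simp add: induced_metric_def)
  show "bilinear_form (smooth_functions A) (gsections A) gmult ?G"
    unfolding bilinear_form_def
  proof (intro conjI ballI)
    fix u v assume u: "u \<in> gsections A" and v: "v \<in> gsections A"
    obtain X \<xi> where uX: "u = (X, \<xi>)" "X \<in> vector_fields A" "\<xi> \<in> one_forms A"
      using u by (rule gsectionsE)
    obtain Y \<eta> where vY: "v = (Y, \<eta>)" "Y \<in> vector_fields A" "\<eta> \<in> one_forms A"
      using v by (rule gsectionsE)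
    note uv = uX(1) vY(1) uX(2,3) vY(2,3)
    show "?G u v \<in> smooth_functions A"
      unfolding uv(1,2) val using uv(3-)
      by (intro smooth_functions_add[OF atlas] metricD(1) sharp_in_vector_fields)
    show "?G (gmult f u) v = f * ?G u v" "?G u (gmult f v) = f * ?G u v"
      if "f \<in> smooth_functions A" for f
      unfolding uv(1,2) gmult_def fst_conv snd_conv val using uv(3-) that
      by (simp_all only: sharp_fmult metricD(5,6) mem distrib_left)
    fix w assume "w \<in> gsections A"
    then obtain W \<omega> where w: "w = (W, \<omega>)" "W \<in> vector_fields A" "\<omega> \<in> one_forms A"
      by (rule gsectionsE)
    show "?G (u + v) w = ?G u w + ?G v w" "?G w (u + v) = ?G w u + ?G w v"
      unfolding uv(1,2) w(1) add_Pair val using uv(3-) w(2-)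
      by (simp_all only: sharp_add metricD(3,4) mem ac_simps)
  qed
  show "?G u v = ?G v u" if "u \<in> gsections A" "v \<in> gsections A" for u v
  proof -
    have "fst u \<in> vector_fields A" "fst v \<in> vector_fields A" "snd u \<in> one_forms A" "snd v \<in> one_forms A"
      using that by (auto simp: gsections_def)
    then show ?thesis
      by (simp add: induced_metric_def metricD(2)[of "fst u" "fst v"]
          metricD(2)[of "sh (snd u)" "sh (snd v)"] sharp_in_vector_fields)
  qed
  show "nondegenerate (gsections A) gzero_at ?G"
    unfolding nondegenerate_def
  proof (intro allI ballI impI)
    fix p u assume gu: "u \<in> gsections A" and z: "\<forall>v\<in>gsections A. ?G u v p = 0"
    obtain X \<xi> where u: "u = (X, \<xi>)" "X \<in> vector_fields A" "\<xi> \<in> one_forms A"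
      using gu by (rule gsectionsE)
    \<comment> \<open>Sections \<open>(Y, 0)\<close> isolate the first summand of the metric,
      sections \<open>(0, flat A g Y)\<close> the second; since \<open>sh\<close> undoes
      \<open>flat\<close>, the latter again test against every field \<open>Y\<close>.\<close>
    have "zero_at p X"
    proof (rule nondegenerateD[OF u(2)])
      fix Y assume "Y \<in> vector_fields A"
      then show "g X Y p = 0"
        using z[rule_format, of "(Y, 0)"] u(3) one_forms_zero
        by (simp add: gsections_def induced_metric_def u(1) sharp_zero metric_at_zero sharp_in_vector_fields)
    qed
    moreover have "zero_at p (sh \<xi>)"
    proof (rule nondegenerateD[OF sharp_in_vector_fields[OF u(3)]])
      fix Y assume "Y \<in> vector_fields A"
      then show "g (sh \<xi>) Y p = 0"
        using z[rule_format, of "(0, flat A g Y)"] u(2) vector_fields_zero[OF atlas]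
        by (simp add: gsections_def induced_metric_def u(1) sharp_flat metric_at_zero flat_in_one_forms)
    qed
    ultimately show "gzero_at p u"
      using u by (simp add: gzero_at_def zero_at_sharp)
  qed
qed

text \<open>An equivalence is required, since the pseudo-Riemannian case has to transfer the failure
  of positive definiteness.\<close>

lemma induced_positive_definite_iff:
  "positive_definite (gsections A) gzero_at (induced_metric A g)
     \<longleftrightarrow> positive_definite (vector_fields A) zero_at g"
proof
  assume pd: "positive_definite (gsections A) gzero_at (induced_metric A g)"
  show "positive_definite (vector_fields A) zero_at g"
    unfolding positive_definite_def
  proof (intro allI ballI impI)
    fix p X assume "X \<in> vector_fields A" "\<not> zero_at p X"
    then have "induced_metric A g (X, 0) (X, 0) p > 0"
      using pd one_forms_zero by (auto simp: positive_definite_def gsections_def gzero_at_def)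
    then show "g X X p > 0"
      by (simp add: induced_metric_def sharp_zero metric_at_zero vector_fields_zero[OF atlas])
  qed
next
  assume pd: "positive_definite (vector_fields A) zero_at g"
  \<comment> \<open>One component of a nonzero section may vanish at \<open>p\<close>, so the value
    on such a component must be known to be 0 there.\<close>
  have nonneg: "0 \<le> g X X p" "\<not> zero_at p X \<Longrightarrow> 0 < g X X p" if "X \<in> vector_fields A" for X p
    using pd metric_zero_at[OF that that, of p] that
    by (cases "zero_at p X"; force simp: positive_definite_def)+
  show "positive_definite (gsections A) gzero_at (induced_metric A g)"
    unfolding positive_definite_def
  proof (intro allI ballI impI)
    fix p u assume gu: "u \<in> gsections A" and nz: "\<not> gzero_at p u"
    obtain X \<xi> where u: "u = (X, \<xi>)" "X \<in> vector_fields A" "\<xi> \<in> one_forms A"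
      using gu by (rule gsectionsE)
    then have "\<not> zero_at p X \<or> \<not> zero_at p (sh \<xi>)"
      using nz by (simp add: gzero_at_def zero_at_sharp)
    then show "induced_metric A g u u p > 0"
      using nonneg[OF u(2)] nonneg[OF sharp_in_vector_fields[OF u(3)]]
      by (auto simp: u(1) induced_metric_def intro: add_pos_nonneg add_nonneg_pos)
  qed
qed

end

subsection \<open>The diagonal structure\<close>

locale almost_complex_metric = metric_on_manifold A g
  for A :: "('m::t2_space, 'e::euclidean_space) chart set"
    and g :: "'m vfield \<Rightarrow> 'm vfield \<Rightarrow> 'm sfun" +
  fixes J :: "'m vfield \<Rightarrow> 'm vfield" and \<epsilon> l :: real
  assumes endo: "module_endo (smooth_functions A) (vector_fields A) fmult J"
    and J_J: "X \<in> vector_fields A \<Longrightarrow> J (J X) = - X"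
    and J_metric: "X \<in> vector_fields A \<Longrightarrow> Y \<in> vector_fields A \<Longrightarrow> g (J X) (J Y) = (\<lambda>_. \<epsilon>) * g X Y"
    and \<epsilon>: "\<epsilon> \<in> {1, -1}" and l: "l \<in> {1, -1}"
begin

abbreviation K :: "'m form \<Rightarrow> 'm form" where "K \<xi> \<equiv> fmult (\<lambda>_. l) (dual_map A J \<xi>)"

lemma J_in_vector_fields: "X \<in> vector_fields A \<Longrightarrow> J X \<in> vector_fields A"
  using endo by (auto simp: module_endo_def)

lemma J_add: "X \<in> vector_fields A \<Longrightarrow> Y \<in> vector_fields A \<Longrightarrow> J (X + Y) = J X + J Y"
  using endo by (auto simp: module_endo_def)

lemma J_fmult: "f \<in> smooth_functions A \<Longrightarrow> X \<in> vector_fields A \<Longrightarrow> J (fmult f X) = fmult f (J X)"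
  using endo by (auto simp: module_endo_def)

lemma J_uminus: "X \<in> vector_fields A \<Longrightarrow> J (- X) = - J X"
  using J_fmult[OF smooth_functions_const[OF atlas, of "- 1"]] by (simp add: fmult_minus_one)

lemma metric_uminus:
  assumes "X \<in> vector_fields A" "Y \<in> vector_fields A"
  shows "g (- X) Y = - g X Y" "g X (- Y) = - g X Y"
  using metricD(5,6)[OF assms smooth_functions_const[OF atlas, of "- 1"]]
  by (simp_all add: fmult_minus_one fun_eq_iff)

text \<open>Replace \<open>Y\<close> by \<open>J Y\<close> in \<open>J_metric\<close> and use that
  \<epsilon> is its own inverse: \<open>J\<close> is skew for \<epsilon> = 1 and self-adjoint for
  \<epsilon> = -1.\<close>

lemma metric_J_left:
  assumes "X \<in> vector_fields A" "Y \<in> vector_fields A"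
  shows "g X (J Y) = (\<lambda>_. - \<epsilon>) * g (J X) Y"
proof -
  have "(\<lambda>_. \<epsilon>) * g X (J Y) = - g (J X) Y"
    using J_metric[OF assms(1) J_in_vector_fields[OF assms(2)]] assms
    by (simp add: J_J metric_uminus J_in_vector_fields)
  then show ?thesis
    using \<epsilon> by (auto simp: fun_eq_iff)
qed

lemma K_in_one_forms: "\<xi> \<in> one_forms A \<Longrightarrow> K \<xi> \<in> one_forms A"
  by (intro one_forms_fmult[OF atlas smooth_functions_const[OF atlas]] dual_map_in_one_forms[OF atlas endo])

lemma K_apply: "X \<in> vector_fields A \<Longrightarrow> K \<xi> X = (\<lambda>_. l) * \<xi> (J X)"
  by (simp add: fmult_def dual_map_def)

lemma K_outside: "X \<notin> vector_fields A \<Longrightarrow> K \<xi> X = 0"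
  by (simp add: fmult_def dual_map_def fun_eq_iff)

lemma K_K:
  assumes "\<xi> \<in> one_forms A"
  shows "K (K \<xi>) = - \<xi>"
proof
  fix X
  show "K (K \<xi>) X = (- \<xi>) X"
  proof (cases "X \<in> vector_fields A")
    case True
    have "\<xi> (- X) = - \<xi> X"
      using one_formsD(4)[OF assms smooth_functions_const[OF atlas, of "- 1"] True]
      by (simp add: fmult_minus_one fun_eq_iff)
    then have "K (K \<xi>) X = (\<lambda>_. l) * ((\<lambda>_. l) * (- \<xi> X))"
      using True by (simp only: K_apply J_in_vector_fields J_J)
    then show ?thesis
      using l by (auto simp: fun_eq_iff)
  next
    case False
    then show ?thesis
      by (simp add: K_outside one_formsD(2)[OF assms])
  qed
qed

lemma sharp_K:
  assumes "\<xi> \<in> one_forms A"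
  shows "sh (K \<xi>) = fmult (\<lambda>_. - (\<epsilon> * l)) (J (sh \<xi>))"
proof (rule sharp_eqI[OF K_in_one_forms[OF assms]])
  note S = sharp_in_vector_fields[OF assms]
  show "fmult (\<lambda>_. - (\<epsilon> * l)) (J (sh \<xi>)) \<in> vector_fields A"
    by (intro vector_fields_fmult[OF atlas smooth_functions_const[OF atlas]] J_in_vector_fields S)
  fix Y assume Y: "Y \<in> vector_fields A"
  have "K \<xi> Y = (\<lambda>_. l) * g (sh \<xi>) (J Y)"
    using Y by (simp only: K_apply metric_sharp[OF assms] J_in_vector_fields)
  also have "\<dots> = (\<lambda>_. - (\<epsilon> * l)) * g (J (sh \<xi>)) Y"
    by (simp add: metric_J_left[OF S Y] fun_eq_iff)
  finally show "g (fmult (\<lambda>_. - (\<epsilon> * l)) (J (sh \<xi>))) Y = K \<xi> Y"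
    using metricD(5)[OF J_in_vector_fields[OF S] Y smooth_functions_const[OF atlas]] by simp
qed

lemma diag_structure_Pair: "diag_structure A l J (X, \<xi>) = (J X, K \<xi>)"
  by (simp add: diag_structure_def gmatrix_def)

lemma generalized_almost_complex_diag: "generalized_almost_complex A (diag_structure A l J)"
  unfolding generalized_almost_complex_def module_endo_def
proof (intro conjI ballI)
  fix u assume "u \<in> gsections A"
  then obtain X \<xi> where u: "u = (X, \<xi>)" "X \<in> vector_fields A" "\<xi> \<in> one_forms A"
    by (rule gsectionsE)
  show "diag_structure A l J u \<in> gsections A"
    using u by (simp add: diag_structure_Pair gsections_def J_in_vector_fields K_in_one_forms)
  show "diag_structure A l J (diag_structure A l J u) = - u"
    using u by (simp add: diag_structure_Pair J_J K_K)
  show "diag_structure A l J (gmult f u) = gmult f (diag_structure A l J u)"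
    if "f \<in> smooth_functions A" for f
  proof -
    have "K (fmult f \<xi>) = fmult f (K \<xi>)"
      by (simp add: fmult_def dual_map_def fun_eq_iff)
    then show ?thesis
      using u that by (simp add: diag_structure_Pair gmult_def J_fmult)
  qed
  fix v assume "v \<in> gsections A"
  then obtain Y \<eta> where v: "v = (Y, \<eta>)" "Y \<in> vector_fields A" "\<eta> \<in> one_forms A"
    by (rule gsectionsE)
  have "K (\<xi> + \<eta>) = K \<xi> + K \<eta>"
    by (simp add: fmult_def dual_map_def fun_eq_iff distrib_left)
  then show "diag_structure A l J (u + v) = diag_structure A l J u + diag_structure A l J v"
    using u v by (simp add: diag_structure_Pair J_add)
qed

lemma compatible_with_sign_diag:
  "compatible_with_sign \<epsilon> A (diag_structure A l J) (induced_metric A g)"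
  unfolding compatible_with_sign_def
proof (intro ballI)
  fix u v assume gu: "u \<in> gsections A" and gv: "v \<in> gsections A"
  obtain X \<xi> where u: "u = (X, \<xi>)" "X \<in> vector_fields A" "\<xi> \<in> one_forms A"
    using gu by (rule gsectionsE)
  obtain Y \<eta> where v: "v = (Y, \<eta>)" "Y \<in> vector_fields A" "\<eta> \<in> one_forms A"
    using gv by (rule gsectionsE)
  note S = sharp_in_vector_fields[OF u(3)] sharp_in_vector_fields[OF v(3)]
  \<comment> \<open>This factor enters once per argument and has square 1, so only the sign
    \<epsilon> of \<open>J\<close> itself survives, for either value of \<open>l\<close>.\<close>
  let ?c = "\<lambda>_. - (\<epsilon> * l)"
  have "g (sh (K \<xi>)) (sh (K \<eta>)) = ?c * (?c * ((\<lambda>_. \<epsilon>) * g (sh \<xi>) (sh \<eta>)))"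
    unfolding sharp_K[OF u(3)] sharp_K[OF v(3)] J_metric[OF S, symmetric] using S
    by (simp only: metricD(5,6) J_in_vector_fields vector_fields_fmult[OF atlas] smooth_functions_const[OF atlas])
  also have "\<dots> = (\<lambda>_. \<epsilon>) * g (sh \<xi>) (sh \<eta>)"
    using \<epsilon> l by (auto simp: fun_eq_iff)
  finally show "induced_metric A g (diag_structure A l J u) (diag_structure A l J v)
      = (\<lambda>_. \<epsilon>) * induced_metric A g u v"
    using u v by (simp add: induced_metric_def diag_structure_Pair J_metric distrib_left)
qed

text \<open>For \<epsilon> = 1 the tensor is skew, so the results on symmetric metrics do not apply
  to it. Instead its \<open>flat\<close> is that of \<open>g\<close> after \<open>J\<close>, whose
  inverse is the inverse \<open>-J\<close> of \<open>J\<close> after \<open>sh\<close>.\<close>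

lemma sharp_fundamental_tensor:
  assumes "\<xi> \<in> one_forms A"
  shows "sharp A (fundamental_tensor J g) \<xi> = - J (sh \<xi>)"
proof -
  let ?\<phi> = "fundamental_tensor J g"
  note S = sharp_in_vector_fields[OF assms]
  have flat: "flat A ?\<phi> X = flat A g (J X)" for X
    by (simp add: flat_def fundamental_tensor_def fun_eq_iff)
  have inj: "inj_on (flat A ?\<phi>) (vector_fields A)"
  proof (rule inj_onI)
    fix X Y assume XY: "X \<in> vector_fields A" "Y \<in> vector_fields A" "flat A ?\<phi> X = flat A ?\<phi> Y"
    then have "J X = J Y"
      using inj_onD[OF flat_inj] J_in_vector_fields flat by metis
    then have "- X = - Y"
      using J_J XY(1,2) by metis
    then show "X = Y" by simp
  qed
  have "J (- J (sh \<xi>)) = sh \<xi>"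
    using S by (simp add: J_uminus J_in_vector_fields J_J)
  moreover have "flat A g (sh \<xi>) = \<xi>"
    using metric_sharp[OF assms] one_formsD(2)[OF assms] by (auto simp: flat_def)
  ultimately have "flat A ?\<phi> (- J (sh \<xi>)) = \<xi>"
    using flat by simp
  moreover have "- J (sh \<xi>) \<in> vector_fields A"
    by (intro vector_fields_uminus[OF atlas] J_in_vector_fields S)
  ultimately show ?thesis
    unfolding sharp_def[of A ?\<phi>] using inv_into_f_f[OF inj] by metis
qed

text \<open>On fields both sides agree by definition. On forms the left side is -\<epsilon>*l times
  \<open>g (J (sh \<xi>)) (sh \<eta>)\<close>, while the value of \<open>\<phi>\<close> on the two
  sharps is \<epsilon> times the same function; this is the origin of the minus sign.\<close>

lemma fundamental_tensor_diag:
  assumes \<xi>: "\<xi> \<in> one_forms A" and \<eta>: "\<eta> \<in> one_forms A"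
  defines "\<phi> \<equiv> fundamental_tensor J g"
  shows "fundamental_tensor (diag_structure A l J) (induced_metric A g) (X, \<xi>) (Y, \<eta>)
    = \<phi> X Y - (\<lambda>_. l) * \<phi> (sharp A \<phi> \<xi>) (sharp A \<phi> \<eta>)"
proof -
  note S = sharp_in_vector_fields[OF \<xi>] sharp_in_vector_fields[OF \<eta>]
  have "g (sh (K \<xi>)) (sh \<eta>) = (\<lambda>_. - (\<epsilon> * l)) * g (J (sh \<xi>)) (sh \<eta>)"
    unfolding sharp_K[OF \<xi>] using S
    by (intro metricD(5) J_in_vector_fields smooth_functions_const[OF atlas])
  moreover have "\<phi> (sharp A \<phi> \<xi>) (sharp A \<phi> \<eta>) = - g (sh \<xi>) (J (sh \<eta>))"
    unfolding \<phi>_def sharp_fundamental_tensor[OF \<xi>] sharp_fundamental_tensor[OF \<eta>] fundamental_tensor_def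
    using S by (simp add: J_uminus J_in_vector_fields J_J metric_uminus)
  ultimately show ?thesis
    by (simp add: fundamental_tensor_def[of "diag_structure A l J"] induced_metric_def diag_structure_Pair
        metric_J_left[OF S] \<phi>_def fundamental_tensor_def[of J] fun_eq_iff)
qed

end

theorem proposition4p16:
  fixes A :: "('m::{t2_space,second_countable_topology}, 'e::euclidean_space) chart set"
    and J :: "'m vfield \<Rightarrow> 'm vfield"
    and g :: "'m vfield \<Rightarrow> 'm vfield \<Rightarrow> 'm sfun"
    and \<alpha> \<epsilon> l :: real
  assumes "metric_manifold \<alpha> \<epsilon> A J g"
    and "\<alpha> = -1"
    and "l \<in> {1, -1}"
  defines "\<phi> \<equiv> fundamental_tensor J g"
  shows "generalized_almost_complex A (diag_structure A l J)
    \<and> compatible A (diag_structure A l J) (induced_metric A g)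
    \<and> (\<epsilon> = 1 \<longrightarrow>
         (riemannian A g \<longrightarrow>
            generalized_almost_hermitian A (diag_structure A l J) (induced_metric A g)) \<and>
         (pseudo_riemannian A g \<longrightarrow>
            generalized_indefinite_almost_hermitian A (diag_structure A l J) (induced_metric A g)))
    \<and> (\<epsilon> = -1 \<longrightarrow>
         generalized_almost_norden A (diag_structure A l J) (induced_metric A g))
    \<and> (\<forall>X\<in>vector_fields A. \<forall>Y\<in>vector_fields A. \<forall>\<xi>\<in>one_forms A. \<forall>\<eta>\<in>one_forms A.
         fundamental_tensor (diag_structure A l J) (induced_metric A g) (X, \<xi>) (Y, \<eta>)
           = \<phi> X Y - (\<lambda>_. l) * \<phi> (sharp A \<phi> \<xi>) (sharp A \<phi> \<eta>))"
proof -
  interpret almost_complex_metric A g J \<epsilon> l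
    using assms(1-3)
    by unfold_locales
       (auto simp: metric_manifold_def riemannian_def pseudo_riemannian_def fmult_minus_one)
  note complex = generalized_almost_complex_diag
  note compat = compatible_with_sign_diag
  note metric = induced_generalized_metric
  have "compatible A (diag_structure A l J) (induced_metric A g)"
    using compat \<epsilon> unfolding compatible_def by blast
  moreover have "generalized_almost_hermitian A (diag_structure A l J) (induced_metric A g)"
    if "\<epsilon> = 1" "riemannian A g"
    using that complex compat metric induced_positive_definite_iff
    by (simp add: generalized_almost_hermitian_def generalized_riemannian_def riemannian_def)
  moreover have "generalized_indefinite_almost_hermitian A (diag_structure A l J) (induced_metric A g)"
    if "\<epsilon> = 1" "pseudo_riemannian A g"
    using that complex compat metric induced_positive_definite_iff
    by (simp add: generalized_indefinite_almost_hermitian_def generalized_pseudo_riemannian_def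
        pseudo_riemannian_def)
  moreover have "generalized_almost_norden A (diag_structure A l J) (induced_metric A g)"
    if "\<epsilon> = - 1"
    using that complex compat metric by (simp add: generalized_almost_norden_def)
  moreover have "fundamental_tensor (diag_structure A l J) (induced_metric A g) (X, \<xi>) (Y, \<eta>)
      = \<phi> X Y - (\<lambda>_. l) * \<phi> (sharp A \<phi> \<xi>) (sharp A \<phi> \<eta>)"
    if "\<xi> \<in> one_forms A" "\<eta> \<in> one_forms A" for X Y \<xi> \<eta>
    unfolding \<phi>_def by (rule fundamental_tensor_diag[OF that])
  ultimately show ?thesis
    using complex by blast
qed

end
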